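(* Let $\mathcal{C}$ be the family of all bivariate copulas endowed with the metric $D_1$, and let $\mathcal{C}^{cd}\subseteq\mathcal{C}$ be the family of all completely dependent copulas. Then $\mathcal{C}^{cd}$ is a $Z$-set in $(\mathcal{C},D_1)$.
   Context: A subset $A$ of a metric space $(\Omega,m)$ is a $Z$-set if it is closed and for every continuous mapping $\varepsilon:\Omega\to(0,1)$ there exists a continuous function $f:\Omega\to\Omega\setminus A$ such that $m(x,f(x))<\varepsilon(x)$ for all $x\in\Omega$. $\lambda$ is Lebesgue measure. A Borel measurable map $h:[0,1]\to[0,1]$ is $\lambda$-preserving if $\lambda(h^{-1}(E))=\lambda(E)$ for all $E\in\mathcal{B}([0,1])$. A bivariate copula is the restriction to $[0,1]^2$ of the distribution function of a probability measure on $[0,1]^2$ with both marginals equal to $\lambda$. For a copula $C$, $\mu_C$ denotes the corresponding doubly stochastic measure, $\mu_C([0,x]\times[0,y])=C(x,y)$, and $K_C:[0,1]\times\mathcal{B}([0,1])\to[0,1]$ denotes (a version of) its Markov kernel: $x\mapsto K_C(x,E)$ is Borel measurable for each Borel set $E$, $K_C(x,\cdot)$ is a probability measure for each $x$, and $\mu_C(G)=\int_{[0,1]}K_C(x,G_x)\,d\lambda(x)$ for every $G\in\mathcal{B}([0,1]^2)$, where $G_x=\{y:(x,y)\in G\}$. The kernel is unique for $\lambda$-a.e. $x$. The metric $D_1$ on $\mathcal{C}$ is $$D_1(C_1,C_2)=\int_{[0,1]}\int_{[0,1]}\big|K_{C_1}(x,[0,y])-K_{C_2}(x,[0,y])\big|\,d\lambda(x)\,d\lambda(y).$$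 A copula $C$ is completely dependent if there is a $\lambda$-preserving $h:[0,1]\to[0,1]$ such that $K(x,E)=\mathbf{1}_E(h(x))$ is a Markov kernel of $C$. *)

theory Defs
  imports "HOL-Probability.Probability"
begin

section \<open>Z-sets in metric spaces\<close>

definition (in Metric_space) Z_set :: "'a set \<Rightarrow> bool" where
  "Z_set A \<longleftrightarrow> closedin mtopology A \<and>
     (\<forall>\<epsilon>. continuous_map mtopology (top_of_set {0<..<1::real}) \<epsilon> \<longrightarrow>
        (\<exists>f. continuous_map mtopology (subtopology mtopology (M - A)) f \<and>
             (\<forall>x\<in>M. d x (f x) < \<epsilon> x)))"

section \<open>Copulas and doubly stochastic measures\<close>

text \<open>Lebesgue measure on the Borel subsets of the unit interval.\<close>

definition lambdaI :: "real measure" where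
  "lambdaI = restrict_space lborel {0..1}"

definition doubly_stochastic :: "(real \<times> real) measure \<Rightarrow> bool" where
  "doubly_stochastic \<mu> \<longleftrightarrow>
     sets \<mu> = sets (lambdaI \<Otimes>\<^sub>M lambdaI) \<and> prob_space \<mu> \<and>
     distr \<mu> lambdaI fst = lambdaI \<and> distr \<mu> lambdaI snd = lambdaI"

text \<open>
  A copula is a function on the unit square only. It is represented by a total function that is
  \<open>undefined\<close> off the square (\<^const>\<open>restrict\<close>), so that HOL equality of copulas is equality on
  the square.
\<close>

definition copulas :: "(real \<times> real \<Rightarrow> real) set" where
  "copulas = {C. \<exists>\<mu>. doubly_stochastic \<mu> \<and>
     C = restrict (\<lambda>(x, y). measure \<mu> ({0..x} \<times> {0..y})) ({0..1} \<times> {0..1})}"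

definition copula_measure :: "(real \<times> real \<Rightarrow> real) \<Rightarrow> (real \<times> real) measure" where
  "copula_measure C = (THE \<mu>. doubly_stochastic \<mu> \<and>
     (\<forall>x\<in>{0..1}. \<forall>y\<in>{0..1}. measure \<mu> ({0..x} \<times> {0..y}) = C (x, y)))"

text \<open>The following facts show that the description in \<open>copula_measure\<close> is proper.\<close>

lemma space_lambdaI [simp]: "space lambdaI = {0..1}"
  by (simp add: lambdaI_def space_restrict_space)

lemma sets_lambdaI: "sets lambdaI = sets (restrict_space borel {0..1})"
  by (simp add: lambdaI_def sets_restrict_space)

lemma sets_lambdaI_pair:
  "sets (lambdaI \<Otimes>\<^sub>M lambdaI) = sets (restrict_space (borel :: (real \<times> real) measure) ({0..1} \<times> {0..1}))"
    (is "sets ?P = sets ?R")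
proof
  have sp: "space ?P = {0..1} \<times> {0..1}" by (simp add: space_pair_measure)
  have m: "(\<lambda>x. x) \<in> lambdaI \<rightarrow>\<^sub>M borel"
    by (auto simp: lambdaI_def intro!: measurable_restrict_space1)
  have "(\<lambda>p. (fst p, snd p)) \<in> ?P \<rightarrow>\<^sub>M (borel \<Otimes>\<^sub>M borel)"
    by (intro measurable_Pair measurable_compose[OF measurable_fst m] measurable_compose[OF measurable_snd m])
  then have "(\<lambda>p. p) \<in> ?P \<rightarrow>\<^sub>M (borel :: (real \<times> real) measure)"
    by (simp add: borel_prod)
  then have id: "(\<lambda>p. p) \<in> ?P \<rightarrow>\<^sub>M ?R"
    by (rule measurable_restrict_space2[rotated]) (simp add: sp)
  show "sets ?R \<subseteq> sets ?P"
  proof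
    fix X assume X: "X \<in> sets ?R"
    then have "X \<subseteq> space ?P" using sets.sets_into_space[OF X] sp by (simp add: space_restrict_space)
    then show "X \<in> sets ?P" using measurable_sets[OF id X] by (simp add: Int_absorb2)
  qed
  have sq: "{0..1} \<times> {0..1} \<in> sets (borel :: (real \<times> real) measure)"
    by (simp add: closed_Times)
  have "A \<times> B \<in> sets ?R" if "A \<in> sets lambdaI" "B \<in> sets lambdaI" for A B
    using that sq by (auto simp: sets_lambdaI sets_restrict_space_iff borel_prod[symmetric])
  then show "sets ?P \<subseteq> sets ?R"
    unfolding sets_pair_measure
    by (intro sets.sigma_sets_subset'[of _ ?R, simplified space_restrict_space, simplified])
       (auto simp: space_restrict_space sets_restrict_space_iff sq)
qed

lemma atLeastAtMost_in_lambdaI: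
  "x \<in> {0..1} \<Longrightarrow> {0..x} \<in> sets lambdaI"
  by (auto simp: sets_lambdaI sets_restrict_space_iff)

lemma doubly_stochastic_unique:
  assumes "doubly_stochastic \<mu>" "doubly_stochastic \<nu>"
    and eq: "\<And>x y. x \<in> {0..1} \<Longrightarrow> y \<in> {0..1} \<Longrightarrow>
      measure \<mu> ({0..x} \<times> {0..y}) = measure \<nu> ({0..x} \<times> {0..y})"
  shows "\<mu> = \<nu>"
proof -
  let ?S = "{0..1::real} \<times> {0..1::real}"
  let ?d = "\<lambda>\<mu>. distr \<mu> (borel :: (real \<times> real) measure) (\<lambda>p. p)"
  have props: "sets \<rho> = sets (restrict_space borel ?S)" "space \<rho> = ?S" "finite_measure \<rho>"
    "(\<lambda>p. p) \<in> \<rho> \<rightarrow>\<^sub>M borel" if "doubly_stochastic \<rho>" for \<rho>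
  proof -
    show s: "sets \<rho> = sets (restrict_space borel ?S)"
      using that by (simp add: doubly_stochastic_def sets_lambdaI_pair)
    from sets_eq_imp_space_eq[OF s] show "space \<rho> = ?S" by (simp add: space_restrict_space)
    show "finite_measure \<rho>" using that by (simp add: doubly_stochastic_def prob_space_def)
    show "(\<lambda>p. p) \<in> \<rho> \<rightarrow>\<^sub>M borel"
      unfolding measurable_cong_sets[OF s refl] by (intro measurable_restrict_space1) simp
  qed
  have val: "emeasure (?d \<rho>) {..p} =
      (if 0 \<le> fst p \<and> 0 \<le> snd p
       then ennreal (measure \<rho> ({0..min 1 (fst p)} \<times> {0..min 1 (snd p)})) else 0)"
    if "doubly_stochastic \<rho>" for \<rho> p
  proof -
    interpret finite_measure \<rho> by (rule props[OF that])
    have "emeasure (?d \<rho>) {..p} = emeasure \<rho> ({..p} \<inter> ?S)"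
      using props(2,4)[OF that] by (subst emeasure_distr) auto
    also have "{..p} \<inter> ?S = {0..min 1 (fst p)} \<times> {0..min 1 (snd p)}"
      by (auto simp: less_eq_prod_def)
    finally show ?thesis by (auto simp: emeasure_eq_measure)
  qed
  have "?d \<mu> = ?d \<nu>"
  proof (rule measure_eqI_generator_eq[where E = "range atMost" and \<Omega> = UNIV
        and A = "\<lambda>n. {..(real n, real n)}"])
    show "Int_stable (range (atMost :: real \<times> real \<Rightarrow> _))"
    proof (rule Int_stableI)
      fix a b :: "(real \<times> real) set" assume "a \<in> range atMost" "b \<in> range atMost"
      then obtain p q where "a = {..p}" "b = {..q}" by blast
      then have "a \<inter> b = {..inf p q}" by auto
      then show "a \<inter> b \<in> range atMost" by blast
    qed
    show "emeasure (?d \<mu>) X = emeasure (?d \<nu>) X" if "X \<in> range atMost" for X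
      using that by (auto simp: val assms(1,2) eq)
    show "sets (?d \<mu>) = sigma_sets UNIV (range atMost)" "sets (?d \<nu>) = sigma_sets UNIV (range atMost)"
      by (simp_all add: borel_eq_atMost[where 'a = "real \<times> real"])
    show "(\<Union>n. {..(real n, real n)}) = UNIV"
    proof -
      have "\<exists>n. p \<le> (real n, real n)" for p :: "real \<times> real"
      proof -
        obtain n where "max (fst p) (snd p) \<le> real n" using real_arch_simple by blast
        then show ?thesis by (intro exI[of _ n]) (simp add: less_eq_prod_def)
      qed
      then show ?thesis by auto
    qed
    show "emeasure (?d \<mu>) {..(real n, real n)} \<noteq> \<infinity>" for n by (simp add: val assms(1))
  qed auto
  show ?thesis
  proof (rule measure_eqI)
    show "sets \<mu> = sets \<nu>" using props(1) assms(1,2) by simp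
    fix X assume X: "X \<in> sets \<mu>"
    have "?S \<in> sets borel" by (simp add: closed_Times)
    then have "X \<in> sets borel \<and> X \<subseteq> ?S"
      using X unfolding props(1)[OF assms(1)] by (auto simp: sets_restrict_space_iff)
    then have "emeasure (?d \<rho>) X = emeasure \<rho> X" if "doubly_stochastic \<rho>" for \<rho>
      using props(2,4)[OF that] by (subst emeasure_distr) (auto simp: Int_absorb2)
    with \<open>?d \<mu> = ?d \<nu>\<close> assms(1,2) show "emeasure \<mu> X = emeasure \<nu> X" by metis
  qed
qed

lemma copula_measure_eqI:
  assumes "doubly_stochastic \<mu>"
    and "\<And>x y. x \<in> {0..1} \<Longrightarrow> y \<in> {0..1} \<Longrightarrow> measure \<mu> ({0..x} \<times> {0..y}) = C (x, y)"
  shows "copula_measure C = \<mu>"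
  unfolding copula_measure_def
  by (rule the_equality) (use assms doubly_stochastic_unique in auto)

section \<open>Markov kernels and the metric\<close>

text \<open>
  Membership in \<open>lambdaI \<rightarrow>\<^sub>M prob_algebra lambdaI\<close> says that every \<open>K x\<close> with \<open>x\<close> in the unit
  interval is a probability measure on the Borel sets of the unit interval and that
  \<open>x \<mapsto> K x E\<close> is measurable for each such Borel set \<open>E\<close>.
\<close>

definition markov_kernel :: "(real \<times> real \<Rightarrow> real) \<Rightarrow> (real \<Rightarrow> real measure) \<Rightarrow> bool" where
  "markov_kernel C K \<longleftrightarrow>
     K \<in> lambdaI \<rightarrow>\<^sub>M prob_algebra lambdaI \<and>
     (\<forall>G \<in> sets (lambdaI \<Otimes>\<^sub>M lambdaI).
        emeasure (copula_measure C) G = (\<integral>\<^sup>+ x. emeasure (K x) {y. (x, y) \<in> G} \<partial>lambdaI))"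

text \<open>Any version will do: two kernels of the same copula agree almost everywhere.\<close>

definition copula_kernel :: "(real \<times> real \<Rightarrow> real) \<Rightarrow> real \<Rightarrow> real measure" where
  "copula_kernel C = (SOME K. markov_kernel C K)"

definition D1 :: "(real \<times> real \<Rightarrow> real) \<Rightarrow> (real \<times> real \<Rightarrow> real) \<Rightarrow> real" where
  "D1 C1 C2 = (\<integral>y. (\<integral>x. \<bar>measure (copula_kernel C1 x) {0..y} - measure (copula_kernel C2 x) {0..y}\<bar>
     \<partial>lambdaI) \<partial>lambdaI)"

section \<open>Complete dependence\<close>

definition lambda_preserving :: "(real \<Rightarrow> real) \<Rightarrow> bool" where
  "lambda_preserving h \<longleftrightarrow> h \<in> lambdaI \<rightarrow>\<^sub>M lambdaI \<and>
     (\<forall>E \<in> sets lambdaI. emeasure lambdaI (h -` E \<inter> {0..1}) = emeasure lambdaI E)"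

text \<open>\<open>return lambdaI (h x)\<close> is the Dirac measure \<open>E \<mapsto> indicator E (h x)\<close> on the Borel sets of the
  unit interval; only the underlying measurable space of \<open>lambdaI\<close> matters.\<close>

definition cd_copulas :: "(real \<times> real \<Rightarrow> real) set" where
  "cd_copulas = {C \<in> copulas. \<exists>h. lambda_preserving h \<and> markov_kernel C (\<lambda>x. return lambdaI (h x))}"

end

theory Submission
  imports Defs
begin

text \<open>
  Every copula \<open>C\<close> is encoded by the function \<open>F\<^sub>C (x, y) = K\<^sub>C (x, [0, y])\<close> on the unit square.
  Once Markov kernels are known to exist and to be unique almost everywhere, \<open>D1\<close> is the
  \<open>L\<^sup>1\<close> distance of these functions, and \<open>F\<^sub>C\<close> determines \<open>C\<close>; hence \<open>D1\<close> is a metric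
  (\<open>Metric_space_D1\<close>).
  
  \<^emph>\<open>Closedness.\<close> A probability measure on the interval is a Dirac measure exactly if its
  distribution function takes only the values 0 and 1. So \<open>C\<close> is completely dependent if and only if
  \<open>spread C = \<integral> F\<^sub>C (1 - F\<^sub>C)\<close> vanishes (\<open>cd_copulas_iff_spread\<close>). As \<open>r \<mapsto> r (1 - r)\<close> is 1-Lipschitz
  on the unit interval, \<open>spread\<close> is 1-Lipschitz for \<open>D1\<close> (\<open>spread_Lipschitz\<close>), and its zero set is
  closed.
  
  \<^emph>\<open>Pushing copulas off the set.\<close> For \<open>t > 0\<close> the copula \<open>(1 - t) C + t \<Pi>\<close>, where
  \<open>\<Pi> (x, y) = x y\<close> is the independence copula, has a kernel with an absolutely continuous part of
  mass at least \<open>t\<close>, so it is not completely dependent. It lies within \<open>t\<close> of \<open>C\<close>, and it depends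
  continuously on \<open>(t, C)\<close>. So the map \<open>C \<mapsto> (1 - t) C + t \<Pi>\<close> with \<open>t = \<epsilon> C / 2\<close> witnesses the
  \<open>Z\<close>-set property for \<open>\<epsilon>\<close>.
  
  The bulk of the work is the existence of the kernels (\<open>kernel_measure_disintegration\<close>). The
  Radon-Nikodym densities of \<open>A \<mapsto> \<mu> (A \<times> [0, q])\<close> for rational \<open>q\<close> prescribe the distribution
  function of \<open>K x\<close> at the rationals, and \<open>K x\<close> is defined as the law of the corresponding quantile
  function. For every version of the densities this is a measurable map into the interval, so one
  definition gives a probability measure \<open>K x\<close> for all \<open>x\<close>, including those where the densities
  are not monotone in \<open>q\<close>.
\<close>

section \<open>Measures on the unit interval\<close>

interpretation lambdaI: prob_space lambdaI
  by (rule prob_spaceI) (simp add: lambdaI_def emeasure_restrict_space space_restrict_space)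

interpretation square: pair_prob_space lambdaI lambdaI ..

lemma sets_lambdaI_iff: "A \<in> sets lambdaI \<longleftrightarrow> A \<in> sets borel \<and> A \<subseteq> {0..1}"
  by (auto simp: sets_lambdaI sets_restrict_space_iff)

lemma id_measurable_lambdaI [measurable]: "(\<lambda>x. x) \<in> borel_measurable lambdaI"
  by (auto simp: lambdaI_def intro!: measurable_restrict_space1)

lemma measurable_lambdaI_iff:
  "f \<in> M \<rightarrow>\<^sub>M lambdaI \<longleftrightarrow> f \<in> borel_measurable M \<and> f \<in> space M \<rightarrow> {0..1}"
proof -
  have "f \<in> M \<rightarrow>\<^sub>M lambdaI \<longleftrightarrow> f \<in> M \<rightarrow>\<^sub>M restrict_space borel {0..1}"
    by (rule arg_cong[where f = "\<lambda>S. f \<in> S"], rule measurable_cong_sets) (simp_all add: sets_lambdaI)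
  then show ?thesis by (auto simp: measurable_restrict_space2_iff)
qed

lemma emeasure_lambdaI: "A \<in> sets lambdaI \<Longrightarrow> emeasure lambdaI A = emeasure lborel A"
  unfolding sets_lambdaI_iff by (simp add: lambdaI_def emeasure_restrict_space)

lemma measure_lambdaI_atLeastAtMost:
  "y \<in> {0..1} \<Longrightarrow> measure lambdaI {0..y} = y"
  by (simp add: measure_def emeasure_lambdaI sets_lambdaI_iff)

lemma space_eq_unit: "sets M = sets lambdaI \<Longrightarrow> space M = {0..1}"
  using sets_eq_imp_space_eq[of M lambdaI] by simp

lemma measure_lambdaI_eqI_lessThan:
  assumes sets: "sets M = sets lambdaI" "sets N = sets lambdaI"
    and fin: "emeasure M {0..1} \<noteq> \<infinity>"
    and total: "emeasure M {0..1} = emeasure N {0..1}"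
    and below: "\<And>a. 0 < a \<Longrightarrow> a \<le> 1 \<Longrightarrow> emeasure M {0..<a} = emeasure N {0..<a}"
  shows "M = N"
proof -
  let ?d = "\<lambda>M. distr M (borel :: real measure) (\<lambda>x. x)"
  have id: "(\<lambda>x. x) \<in> borel_measurable L" if "sets L = sets lambdaI" for L
    using id_measurable_lambdaI measurable_cong_sets[OF that refl] by blast
  have val: "emeasure (?d L) {..<a} =
      (if a \<le> 0 then 0 else if a \<le> 1 then emeasure L {0..<a} else emeasure L {0..1})"
    if L: "sets L = sets lambdaI" for L a
  proof -
    have "emeasure (?d L) {..<a} = emeasure L ({..<a} \<inter> {0..1})"
      using id[OF L] space_eq_unit[OF L] by (subst emeasure_distr) auto
    also have "{..<a} \<inter> {0..1} = (if a \<le> 0 then {} else if a \<le> 1 then {0..<a} else {0..1})"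
      by auto
    finally show ?thesis by simp
  qed
  have "?d M = ?d N"
  proof (rule measure_eqI_generator_eq[where E = "range lessThan" and \<Omega> = UNIV and A = "\<lambda>n. {..<real n}"])
    show "Int_stable (range (lessThan :: real \<Rightarrow> _))"
    proof (rule Int_stableI)
      fix a b :: "real set" assume "a \<in> range lessThan" "b \<in> range lessThan"
      then obtain p q where "a = {..<p}" "b = {..<q}" by blast
      then have "a \<inter> b = {..<min p q}" by auto
      then show "a \<inter> b \<in> range lessThan" by blast
    qed
    show "emeasure (?d M) X = emeasure (?d N) X" if "X \<in> range lessThan" for X
      using that by (auto simp: val sets total below)
    show "sets (?d M) = sigma_sets UNIV (range lessThan)" "sets (?d N) = sigma_sets UNIV (range lessThan)"
      by (simp_all add: borel_Iio)
    show "(\<Union>n. {..<real n}) = UNIV"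
      using reals_Archimedean2 by auto
    show "emeasure (?d M) {..<real n} \<noteq> \<infinity>" for n
    proof -
      have "emeasure M A \<noteq> \<infinity>" for A
        using emeasure_space[of M A] fin by (auto simp: space_eq_unit sets top_unique)
      then show ?thesis by (simp add: val sets)
    qed
  qed auto
  show ?thesis
  proof (rule measure_eqI)
    show "sets M = sets N" using sets by simp
    fix X assume X: "X \<in> sets M"
    then have "emeasure (?d L) X = emeasure L X" if "sets L = sets lambdaI" for L
      using id[OF that] space_eq_unit[OF that] sets
      by (subst emeasure_distr) (auto simp: sets_lambdaI_iff Int_absorb2)
    with \<open>?d M = ?d N\<close> sets show "emeasure M X = emeasure N X" by metis
  qed
qed

text \<open>
  Agreement of the distribution functions at almost all points suffices for agreement of the
  measures of the half-open intervals, because every point is a limit from the left of points of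
  agreement. One inequality is enough by symmetry.
\<close>

lemma emeasure_lessThan_le_of_AE_atMost:
  assumes sets: "sets M = sets lambdaI" "sets N = sets lambdaI"
    and ae: "AE y in lambdaI. emeasure M {0..y} = emeasure N {0..y}"
    and a: "0 < a" "a \<le> 1"
  shows "emeasure M {0..<a} \<le> emeasure N {0..<a}"
proof -
  have *: "emeasure M {0..b} \<le> emeasure N {0..<a}" if b: "b < a" for b
  proof -
    let ?b = "max b 0"
    \<comment> \<open>an interval of positive length contains a point of agreement\<close>
    have "\<exists>y\<in>{?b<..<a}. emeasure M {0..y} = emeasure N {0..y}"
    proof (rule ccontr)
      assume none: "\<not> ?thesis"
      have "AE y in lambdaI. y \<notin> {?b<..<a}"
        using ae by eventually_elim (use none in blast)
      moreover have "{y \<in> space lambdaI. \<not> y \<notin> {?b<..<a}} = {?b<..<a}"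
        using a by auto
      ultimately have "emeasure lambdaI {?b<..<a} = 0"
        using a AE_iff_measurable[of "{?b<..<a}" lambdaI "\<lambda>y. y \<notin> {?b<..<a}"]
        by (simp add: sets_lambdaI_iff subset_eq)
      then show False using a b
        by (subst (asm) emeasure_lambdaI) (auto simp: sets_lambdaI_iff max_def split: if_splits)
    qed
    then obtain y where y: "?b < y" "y < a" "emeasure M {0..y} = emeasure N {0..y}" by auto
    have "emeasure M {0..b} \<le> emeasure M {0..y}"
      using y a by (intro emeasure_mono) (auto simp: sets sets_lambdaI_iff)
    also have "\<dots> \<le> emeasure N {0..<a}"
      unfolding y(3) using y a by (intro emeasure_mono) (auto simp: sets sets_lambdaI_iff)
    finally show ?thesis .
  qed
  have "{0..<a} = (\<Union>n. {0..a - inverse (real (Suc n))})"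
  proof (safe, goal_cases)
    case (1 x)
    then obtain n where "inverse (real (Suc n)) < a - x"
      using reals_Archimedean[of "a - x"] by auto
    with 1 show ?case by (auto intro!: exI[of _ n])
  next
    case (2 x n)
    have "inverse (real (Suc n)) > 0" by simp
    with 2 show ?case by (auto simp del: inverse_positive_iff_positive)
  qed
  then have "emeasure M {0..<a} = emeasure M (\<Union>n. {0..a - inverse (real (Suc n))})" by simp
  also have "\<dots> = (SUP n. emeasure M {0..a - inverse (real (Suc n))})"
  proof (rule SUP_emeasure_incseq[symmetric])
    have "0 < inverse (real (Suc n))" for n by simp
    then have "a - inverse (real (Suc n)) \<le> 1" for n using a(2) by (smt (verit))
    then show "range (\<lambda>n. {0..a - inverse (real (Suc n))}) \<subseteq> sets M"
      by (auto simp: sets sets_lambdaI_iff simp del: of_nat_Suc intro: order_trans)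
    show "incseq (\<lambda>n. {0..a - inverse (real (Suc n))})"
      by (rule incseq_SucI) (auto simp: field_simps)
  qed
  also have "\<dots> \<le> emeasure N {0..<a}"
    by (rule SUP_least, rule *) simp
  finally show ?thesis .
qed

lemma measure_lambdaI_eqI_AE:
  assumes sets: "sets M = sets lambdaI" "sets N = sets lambdaI"
    and "prob_space M" "prob_space N"
    and ae: "AE y in lambdaI. measure M {0..y} = measure N {0..y}"
  shows "M = N"
proof -
  interpret M: prob_space M by fact
  interpret N: prob_space N by fact
  have ae': "AE y in lambdaI. emeasure M {0..y} = emeasure N {0..y}"
    using ae by (simp add: M.emeasure_eq_measure N.emeasure_eq_measure)
  then have ae'': "AE y in lambdaI. emeasure N {0..y} = emeasure M {0..y}" by eventually_elim simp
  show ?thesis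
  proof (rule measure_lambdaI_eqI_lessThan[OF sets])
    show "emeasure M {0..1} = emeasure N {0..1}"
      using M.emeasure_space_1 N.emeasure_space_1 space_eq_unit[OF sets(1)] space_eq_unit[OF sets(2)] by simp
  qed (auto intro!: antisym emeasure_lessThan_le_of_AE_atMost sets ae' ae'')
qed

section \<open>Doubly stochastic measures and kernels\<close>

abbreviation square_measure :: "(real \<times> real) measure" where
  "square_measure \<equiv> lambdaI \<Otimes>\<^sub>M lambdaI"

definition kernel_measure :: "(real \<Rightarrow> real measure) \<Rightarrow> (real \<times> real) measure" where
  "kernel_measure K = lambdaI \<bind> (\<lambda>x. distr (K x) square_measure (Pair x))"

lemma
  assumes K: "K \<in> lambdaI \<rightarrow>\<^sub>M prob_algebra lambdaI"
  shows sets_kernel_measure: "sets (kernel_measure K) = sets square_measure"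
    and emeasure_kernel_measure: "G \<in> sets square_measure \<Longrightarrow>
      emeasure (kernel_measure K) G = (\<integral>\<^sup>+ x. emeasure (K x) {y. (x, y) \<in> G} \<partial>lambdaI)"
proof -
  have [measurable]: "K \<in> lambdaI \<rightarrow>\<^sub>M prob_algebra lambdaI" by fact
  have L: "lambdaI \<in> space (prob_algebra lambdaI)"
    by (simp add: space_prob_algebra lambdaI.prob_space_axioms)
  have D: "(\<lambda>x. distr (K x) square_measure (Pair x)) \<in> lambdaI \<rightarrow>\<^sub>M prob_algebra square_measure"
    by measurable
  show "sets (kernel_measure K) = sets square_measure"
    unfolding kernel_measure_def by (rule sets_bind'[OF L D])
  assume G: "G \<in> sets square_measure"
  have "emeasure (kernel_measure K) G = (\<integral>\<^sup>+ x. emeasure (distr (K x) square_measure (Pair x)) G \<partial>lambdaI)"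
    unfolding kernel_measure_def by (rule emeasure_bind_prob_algebra[OF L D G])
  also have "\<dots> = (\<integral>\<^sup>+ x. emeasure (K x) {y. (x, y) \<in> G} \<partial>lambdaI)"
  proof (rule nn_integral_cong)
    fix x assume x: "x \<in> space lambdaI"
    with measurable_space[OF K x] have s: "sets (K x) = sets lambdaI"
      by (simp add: space_prob_algebra)
    have "Pair x \<in> K x \<rightarrow>\<^sub>M square_measure"
      unfolding measurable_cong_sets[OF s refl] using x by measurable
    moreover have "{y. (x, y) \<in> G} \<subseteq> space (K x)"
      using sets.sets_into_space[OF G] space_eq_unit[OF s] by (auto simp: space_pair_measure)
    then have "Pair x -` G \<inter> space (K x) = {y. (x, y) \<in> G}" by auto
    ultimately show "emeasure (distr (K x) square_measure (Pair x)) G = emeasure (K x) {y. (x, y) \<in> G}"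
      using G by (simp add: emeasure_distr)
  qed
  finally show "emeasure (kernel_measure K) G = \<dots>" .
qed

lemma kernelD:
  assumes K: "K \<in> lambdaI \<rightarrow>\<^sub>M prob_algebra lambdaI" and x: "x \<in> {0..1}"
  shows "prob_space (K x)" "sets (K x) = sets lambdaI"
  using measurable_space[OF K, of x] x by (auto simp: space_prob_algebra)

lemma emeasure_kernel_measure_Times:
  assumes K: "K \<in> lambdaI \<rightarrow>\<^sub>M prob_algebra lambdaI"
    and A: "A \<in> sets lambdaI" and E: "E \<in> sets lambdaI"
  shows "emeasure (kernel_measure K) (A \<times> E) = (\<integral>\<^sup>+ x. emeasure (K x) E * indicator A x \<partial>lambdaI)"
  using A E by (subst emeasure_kernel_measure[OF K])
    (auto intro!: nn_integral_cong simp: indicator_def)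

definition copula_of :: "(real \<times> real) measure \<Rightarrow> real \<times> real \<Rightarrow> real" where
  "copula_of \<mu> = restrict (\<lambda>(x, y). measure \<mu> ({0..x} \<times> {0..y})) ({0..1} \<times> {0..1})"

lemma copula_measure_copula_of: "doubly_stochastic \<mu> \<Longrightarrow> copula_measure (copula_of \<mu>) = \<mu>"
  by (rule copula_measure_eqI) (auto simp: copula_of_def)

lemma copula_of_in_copulas: "doubly_stochastic \<mu> \<Longrightarrow> copula_of \<mu> \<in> copulas"
  by (auto simp: copulas_def copula_of_def)

lemma
  assumes "C \<in> copulas"
  shows doubly_stochastic_copula_measure: "doubly_stochastic (copula_measure C)"
    and copula_of_copula_measure: "copula_of (copula_measure C) = C"
proof -
  obtain \<mu> where \<mu>: "doubly_stochastic \<mu>" "C = copula_of \<mu>"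
    using assms by (auto simp: copulas_def copula_of_def)
  then show "doubly_stochastic (copula_measure C)" "copula_of (copula_measure C) = C"
    by (simp_all add: copula_measure_copula_of)
qed

text \<open>
  This turns all questions on Markov kernels of copulas into equations between measures on the square.
\<close>

lemma markov_kernel_iff:
  assumes C: "C \<in> copulas" and K: "K \<in> lambdaI \<rightarrow>\<^sub>M prob_algebra lambdaI"
  shows "markov_kernel C K \<longleftrightarrow> copula_measure C = kernel_measure K"
proof -
  have "sets (copula_measure C) = sets square_measure"
    using doubly_stochastic_copula_measure[OF C] by (simp add: doubly_stochastic_def)
  then show ?thesis
    using K by (auto simp: markov_kernel_def emeasure_kernel_measure sets_kernel_measure
        intro!: measure_eqI)
qed

lemma doubly_stochasticI:
  assumes s: "sets \<mu> = sets square_measure"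
    and fst: "\<And>A. A \<in> sets lambdaI \<Longrightarrow> emeasure \<mu> (A \<times> {0..1}) = emeasure lambdaI A"
    and snd: "\<And>E. E \<in> sets lambdaI \<Longrightarrow> emeasure \<mu> ({0..1} \<times> E) = emeasure lambdaI E"
  shows "doubly_stochastic \<mu>"
proof -
  have sp: "space \<mu> = {0..1} \<times> {0..1}"
    using sets_eq_imp_space_eq[OF s] by (simp add: space_pair_measure)
  have I: "{0..1} \<in> sets lambdaI" by (simp add: sets_lambdaI_iff)
  have [measurable]: "fst \<in> \<mu> \<rightarrow>\<^sub>M lambdaI" "snd \<in> \<mu> \<rightarrow>\<^sub>M lambdaI"
    by (simp_all add: measurable_cong_sets[OF s refl])
  have "prob_space \<mu>"
    by (rule prob_spaceI) (simp add: sp fst[OF I] lambdaI.emeasure_space_1[simplified])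
  moreover have "distr \<mu> lambdaI fst = lambdaI"
  proof (rule measure_eqI)
    fix A assume "A \<in> sets (distr \<mu> lambdaI fst)"
    then have A: "A \<in> sets lambdaI" by simp
    then have "fst -` A \<inter> space \<mu> = A \<times> {0..1}" by (auto simp: sp sets_lambdaI_iff)
    then show "emeasure (distr \<mu> lambdaI fst) A = emeasure lambdaI A"
      using A by (simp add: emeasure_distr fst)
  qed simp
  moreover have "distr \<mu> lambdaI snd = lambdaI"
  proof (rule measure_eqI)
    fix E assume "E \<in> sets (distr \<mu> lambdaI snd)"
    then have E: "E \<in> sets lambdaI" by simp
    then have "snd -` E \<inter> space \<mu> = {0..1} \<times> E" by (auto simp: sp sets_lambdaI_iff)
    then show "emeasure (distr \<mu> lambdaI snd) E = emeasure lambdaI E"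
      using E by (simp add: emeasure_distr snd)
  qed simp
  ultimately show ?thesis using s by (simp add: doubly_stochastic_def)
qed

lemma
  assumes \<mu>: "doubly_stochastic \<mu>"
  shows doubly_stochastic_sets: "sets \<mu> = sets square_measure"
    and doubly_stochastic_fst: "A \<in> sets lambdaI \<Longrightarrow> emeasure \<mu> (A \<times> {0..1}) = emeasure lambdaI A"
    and doubly_stochastic_snd: "A \<in> sets lambdaI \<Longrightarrow> emeasure \<mu> ({0..1} \<times> A) = emeasure lambdaI A"
proof -
  show s: "sets \<mu> = sets square_measure"
    using \<mu> by (simp add: doubly_stochastic_def)
  have sp: "space \<mu> = {0..1} \<times> {0..1}"
    using sets_eq_imp_space_eq[OF s] by (simp add: space_pair_measure)
  have [measurable]: "fst \<in> \<mu> \<rightarrow>\<^sub>M lambdaI" "snd \<in> \<mu> \<rightarrow>\<^sub>M lambdaI"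
    by (simp_all add: measurable_cong_sets[OF s refl])
  assume A: "A \<in> sets lambdaI"
  have "fst -` A \<inter> space \<mu> = A \<times> {0..1}" "snd -` A \<inter> space \<mu> = {0..1} \<times> A"
    using A by (auto simp: sp sets_lambdaI_iff)
  then have "emeasure (distr \<mu> lambdaI fst) A = emeasure \<mu> (A \<times> {0..1})"
    "emeasure (distr \<mu> lambdaI snd) A = emeasure \<mu> ({0..1} \<times> A)"
    using A by (simp_all add: emeasure_distr)
  then show "emeasure \<mu> (A \<times> {0..1}) = emeasure lambdaI A" "emeasure \<mu> ({0..1} \<times> A) = emeasure lambdaI A"
    using \<mu> by (simp_all add: doubly_stochastic_def)
qed

section \<open>Existence of Markov kernels\<close>

definition strip :: "(real \<times> real) measure \<Rightarrow> real set \<Rightarrow> real measure" where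
  "strip \<mu> E = distr (density \<mu> (indicator ({0..1} \<times> E))) lambdaI fst"

lemma sets_strip [simp]: "sets (strip \<mu> E) = sets lambdaI"
  by (simp add: strip_def)

lemma emeasure_strip:
  assumes s: "sets \<mu> = sets square_measure" and A: "A \<in> sets lambdaI" and E: "E \<in> sets lambdaI"
  shows "emeasure (strip \<mu> E) A = emeasure \<mu> (A \<times> E)"
proof -
  have I: "{0..1} \<in> sets lambdaI" by (simp add: sets_lambdaI_iff)
  have sp: "space \<mu> = {0..1} \<times> {0..1}"
    using sets_eq_imp_space_eq[OF s] by (simp add: space_pair_measure)
  have [measurable]: "fst \<in> \<mu> \<rightarrow>\<^sub>M lambdaI"
    by (simp add: measurable_cong_sets[OF s refl])
  have eq: "fst -` A \<inter> space \<mu> = A \<times> {0..1}" using A by (auto simp: sp sets_lambdaI_iff)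
  have [measurable]: "{0..1} \<times> E \<in> sets \<mu>" "A \<times> {0..1} \<in> sets \<mu>"
    unfolding s using I A E by auto
  have "emeasure (strip \<mu> E) A = (\<integral>\<^sup>+ p. indicator ({0..1} \<times> E) p * indicator (A \<times> {0..1}) p \<partial>\<mu>)"
    unfolding strip_def using A by (simp add: emeasure_distr emeasure_density eq)
  also have "\<dots> = (\<integral>\<^sup>+ p. indicator (A \<times> E) p \<partial>\<mu>)"
    using A E by (intro nn_integral_cong) (auto simp: indicator_def sets_lambdaI_iff)
  also have "\<dots> = emeasure \<mu> (A \<times> E)"
    using A E by (simp add: s)
  finally show ?thesis .
qed

text \<open>
  For each fixed Borel set \<open>E\<close> this is a version of the conditional probability of the second
  coordinate lying in \<open>E\<close> given the first coordinate; the exceptional null set depends on \<open>E\<close>.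
\<close>

definition strip_density :: "(real \<times> real) measure \<Rightarrow> real set \<Rightarrow> real \<Rightarrow> ennreal" where
  "strip_density \<mu> E = RN_deriv lambdaI (strip \<mu> E)"

lemma strip_density_measurable [measurable]: "strip_density \<mu> E \<in> borel_measurable lambdaI"
  by (simp add: strip_density_def)

lemma density_strip_density:
  assumes \<mu>: "doubly_stochastic \<mu>" and E: "E \<in> sets lambdaI"
  shows "density lambdaI (strip_density \<mu> E) = strip \<mu> E"
  unfolding strip_density_def
proof (rule lambdaI.density_RN_deriv)
  show "absolutely_continuous lambdaI (strip \<mu> E)"
    unfolding absolutely_continuous_def
  proof
    fix A assume "A \<in> null_sets lambdaI"
    then have A: "A \<in> sets lambdaI" "emeasure lambdaI A = 0" by auto
    note s = doubly_stochastic_sets[OF \<mu>]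
    have "emeasure (strip \<mu> E) A \<le> emeasure \<mu> (A \<times> {0..1})"
      unfolding emeasure_strip[OF s A(1) E] using A E
      by (intro emeasure_mono) (auto simp: s sets_lambdaI_iff)
    then show "A \<in> null_sets (strip \<mu> E)"
      using A by (auto simp: doubly_stochastic_fst[OF \<mu>])
  qed
qed simp

lemma nn_integral_strip_density:
  assumes \<mu>: "doubly_stochastic \<mu>" and A: "A \<in> sets lambdaI" and E: "E \<in> sets lambdaI"
  shows "(\<integral>\<^sup>+ x. strip_density \<mu> E x * indicator A x \<partial>lambdaI) = emeasure \<mu> (A \<times> E)"
  using emeasure_density[of "strip_density \<mu> E" lambdaI A] A
  by (simp add: density_strip_density[OF \<mu> E] emeasure_strip[OF doubly_stochastic_sets[OF \<mu>] A E])

lemma strip_density_unit: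
  assumes \<mu>: "doubly_stochastic \<mu>"
  shows "AE x in lambdaI. strip_density \<mu> {0..1} x = 1"
proof (rule lambdaI.density_unique)
  have I: "{0..1} \<in> sets lambdaI" by (simp add: sets_lambdaI_iff)
  have "strip \<mu> {0..1} = lambdaI"
    by (rule measure_eqI) (simp_all add: emeasure_strip[OF doubly_stochastic_sets[OF \<mu>]] I doubly_stochastic_fst[OF \<mu>])
  then show "density lambdaI (strip_density \<mu> {0..1}) = density lambdaI (\<lambda>_. 1)"
    by (simp add: density_strip_density[OF \<mu> I] density_1)
qed simp_all

text \<open>
  The density of \<open>E\<close> is almost everywhere the sum of those of \<open>D\<close> and of \<open>E - D\<close>.
\<close>

lemma strip_density_mono:
  assumes \<mu>: "doubly_stochastic \<mu>" and D: "D \<in> sets lambdaI" and E: "E \<in> sets lambdaI" and "D \<subseteq> E"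
  shows "AE x in lambdaI. strip_density \<mu> D x \<le> strip_density \<mu> E x"
proof -
  have ED: "E - D \<in> sets lambdaI" using D E by auto
  have "density lambdaI (\<lambda>x. strip_density \<mu> D x + strip_density \<mu> (E - D) x) = density lambdaI (strip_density \<mu> E)"
  proof (rule measure_eqI)
    fix A assume "A \<in> sets (density lambdaI (\<lambda>x. strip_density \<mu> D x + strip_density \<mu> (E - D) x))"
    then have A: "A \<in> sets lambdaI" by simp
    have "emeasure \<mu> (A \<times> D) + emeasure \<mu> (A \<times> (E - D)) = emeasure \<mu> (A \<times> D \<union> A \<times> (E - D))"
      using A D ED by (intro plus_emeasure) (auto simp: doubly_stochastic_sets[OF \<mu>])
    also have "A \<times> D \<union> A \<times> (E - D) = A \<times> E" using \<open>D \<subseteq> E\<close> by auto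
    finally show "emeasure (density lambdaI (\<lambda>x. strip_density \<mu> D x + strip_density \<mu> (E - D) x)) A
        = emeasure (density lambdaI (strip_density \<mu> E)) A"
      using A by (simp add: emeasure_density distrib_right nn_integral_add
          nn_integral_strip_density[OF \<mu> A D] nn_integral_strip_density[OF \<mu> A E]
          nn_integral_strip_density[OF \<mu> A ED])
  qed simp
  then have "AE x in lambdaI. strip_density \<mu> D x + strip_density \<mu> (E - D) x = strip_density \<mu> E x"
    by (intro lambdaI.density_unique) auto
  then show ?thesis by eventually_elim (metis le_iff_add)
qed

abbreviation levels :: "real set" where "levels \<equiv> \<rat> \<inter> {0..1}"

text \<open>
  The generalised inverse of \<open>q \<mapsto> strip_density \<mu> {0..q} x\<close> over the rationals. Inserting 1 makes the
  set nonempty, so that the infimum lies in the unit interval for all \<open>x\<close> and \<open>u\<close>, even where the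
  densities fail to be monotone in \<open>q\<close> or bounded by 1.
\<close>

definition quantile :: "(real \<times> real) measure \<Rightarrow> real \<Rightarrow> real \<Rightarrow> real" where
  "quantile \<mu> x u = Inf (insert 1 {q \<in> levels. ennreal u \<le> strip_density \<mu> {0..q} x})"

definition disintegration :: "(real \<times> real) measure \<Rightarrow> real \<Rightarrow> real measure" where
  "disintegration \<mu> x = distr lambdaI lambdaI (quantile \<mu> x)"

lemma countable_levels: "countable levels"
  by (simp add: countable_Int1 countable_rat)

lemma level_interval: "q \<in> levels \<Longrightarrow> {0..q} \<in> sets lambdaI"
  by (auto simp: sets_lambdaI_iff)

text \<open>
  The strict inequality reduces to countably many conditions on the densities. For this reason the
  half-open intervals \<open>{0..<a}\<close>, and not the closed ones, are used to compute the kernel.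
\<close>

lemma quantile_less_iff:
  "quantile \<mu> x u < a \<longleftrightarrow> 1 < a \<or> (\<exists>q\<in>levels. q < a \<and> ennreal u \<le> strip_density \<mu> {0..q} x)"
  unfolding quantile_def by (subst cInf_less_iff) (auto intro!: bdd_belowI[of _ 0])

lemma quantile_in_unit: "quantile \<mu> x u \<in> {0..1}"
proof -
  let ?Q = "insert 1 {q \<in> levels. ennreal u \<le> strip_density \<mu> {0..q} x}"
  have "0 \<le> Inf ?Q" by (rule cInf_greatest) auto
  moreover have "Inf ?Q \<le> 1" by (rule cInf_lower) (auto intro: bdd_belowI[of _ 0])
  ultimately show ?thesis by (simp add: quantile_def)
qed

lemma quantile_measurable: "(\<lambda>(x, u). quantile \<mu> x u) \<in> square_measure \<rightarrow>\<^sub>M lambdaI"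
proof -
  have "(\<lambda>p. quantile \<mu> (fst p) (snd p)) \<in> borel_measurable square_measure"
  proof (rule borel_measurableI_less)
    fix a
    have [measurable]: "snd \<in> borel_measurable square_measure"
      using measurable_compose[OF measurable_snd id_measurable_lambdaI] by simp
    have "{p \<in> space square_measure. \<exists>q\<in>levels. q < a \<and> ennreal (snd p) \<le> strip_density \<mu> {0..q} (fst p)}
      \<in> sets square_measure"
      by (rule sets.sets_Collect_countable_Ex'[OF _ countable_levels]) measurable
    then show "{p \<in> space square_measure. quantile \<mu> (fst p) (snd p) < a} \<in> sets square_measure"
      unfolding quantile_less_iff by (cases "1 < a") simp_all
  qed
  then show ?thesis
    unfolding measurable_lambdaI_iff split_beta' using quantile_in_unit by blast
qed

lemma disintegration_kernel: "disintegration \<mu> \<in> lambdaI \<rightarrow>\<^sub>M prob_algebra lambdaI"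
  unfolding disintegration_def
  by (rule measurable_distr_prob_space2[OF _ quantile_measurable])
    (simp add: space_prob_algebra lambdaI.prob_space_axioms)

text \<open>
  The quantile falls below \<open>a\<close> for those \<open>u\<close> that are dominated by one of the densities, and
  these \<open>u\<close> form an interval starting at 0 whose length is the supremum of the densities.
\<close>

lemma emeasure_disintegration:
  assumes x: "x \<in> {0..1}" and a: "0 < a" "a \<le> 1"
    and le1: "(SUP q\<in>levels \<inter> {..<a}. strip_density \<mu> {0..q} x) \<le> 1" (is "?s \<le> 1")
  shows "emeasure (disintegration \<mu> x) {0..<a} = ?s"
proof -
  let ?S = "{u \<in> {0..1}. \<exists>q\<in>levels. q < a \<and> ennreal u \<le> strip_density \<mu> {0..q} x}"
  have m: "quantile \<mu> x \<in> lambdaI \<rightarrow>\<^sub>M lambdaI"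
    using measurable_Pair2[OF quantile_measurable, of x] x by simp
  have a': "{0..<a} \<in> sets lambdaI" using a by (auto simp: sets_lambdaI_iff)
  have eq: "quantile \<mu> x -` {0..<a} \<inter> space lambdaI = ?S"
  proof -
    have "quantile \<mu> x -` {0..<a} \<inter> space lambdaI = {u \<in> {0..1}. quantile \<mu> x u < a}"
      using quantile_in_unit[of \<mu> x] by auto
    also have "\<dots> = ?S" using a by (simp add: quantile_less_iff)
    finally show ?thesis .
  qed
  have S: "?S \<in> sets lambdaI"
    using measurable_sets[OF m a'] unfolding eq .
  obtain r where r: "?s = ennreal r" "0 \<le> r" "r \<le> 1"
    using le1 by (cases ?s) (auto simp: top_unique)
  have below: "u \<in> ?S" if "u \<in> {0..<r}" for u
  proof -
    have "ennreal u < ?s" using that by (simp add: r ennreal_less_iff)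
    then obtain q where "q \<in> levels \<inter> {..<a}" "ennreal u < strip_density \<mu> {0..q} x"
      by (auto simp: less_SUP_iff)
    then show ?thesis using that r by (auto intro!: bexI[of _ q])
  qed
  have above: "u \<in> {0..r}" if u: "u \<in> ?S" for u
  proof -
    obtain q where "q \<in> levels \<inter> {..<a}" "ennreal u \<le> strip_density \<mu> {0..q} x"
      using u by auto
    then have "ennreal u \<le> ennreal r"
      unfolding r(1)[symmetric] by (metis (no_types, lifting) SUP_upper order_trans)
    then show ?thesis using u r by simp
  qed
  have "ennreal r = emeasure lambdaI {0..<r}"
    using r by (subst emeasure_lambdaI) (auto simp: sets_lambdaI_iff)
  also have "\<dots> \<le> emeasure lambdaI ?S"
    using below by (intro emeasure_mono S) blast
  finally have 1: "ennreal r \<le> emeasure lambdaI ?S" .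
  have "emeasure lambdaI ?S \<le> emeasure lambdaI {0..r}"
    using above r by (intro emeasure_mono) (blast, auto simp: sets_lambdaI_iff)
  also have "\<dots> = ennreal r"
    using r by (subst emeasure_lambdaI) (auto simp: sets_lambdaI_iff)
  finally have "emeasure lambdaI ?S = ennreal r" using 1 by (rule antisym)
  then show ?thesis
    by (simp only: disintegration_def emeasure_distr[OF m a'] eq r(1))
qed

text \<open>
  The supremum over rationals below \<open>a\<close> has to become a monotone limit before it can be interchanged
  with an integral.
\<close>

lemma levels_sequence:
  assumes "0 < a" "a \<le> (1::real)"
  obtains q where "\<And>n. q n \<in> levels" "\<And>n. q n < a" "incseq q" "\<And>b. b < a \<Longrightarrow> \<exists>n. b < q n"
proof
  \<comment> \<open>the largest dyadic number of denominator \<open>2 ^ n\<close> strictly below \<open>a\<close>\<close>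
  define q :: "nat \<Rightarrow> real" where "q n = (of_int \<lceil>2 ^ n * a\<rceil> - 1) / 2 ^ n" for n
  show less: "q n < a" for n
    using ceiling_correct[of "2 ^ n * a"] by (simp add: q_def field_simps)
  have "0 \<le> q n" for n
  proof -
    have "0 < \<lceil>2 ^ n * a\<rceil>" using assms by simp
    then show ?thesis by (simp add: q_def)
  qed
  moreover have "q n \<in> \<rat>" for n
    by (auto simp: q_def)
  ultimately show "q n \<in> levels" for n using less[of n] assms by (auto simp: less_imp_le)
  show "incseq q"
  proof (rule incseq_SucI)
    fix n
    have "2 * \<lceil>2 ^ n * a\<rceil> - 1 \<le> \<lceil>2 * (2 ^ n * a)\<rceil>" by linarith
    then have "2 * real_of_int \<lceil>2 ^ n * a\<rceil> - 1 \<le> real_of_int \<lceil>2 * (2 ^ n * a)\<rceil>" by linarith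
    then have "(2 * real_of_int \<lceil>2 ^ n * a\<rceil> - 1 - 1) / (2 * 2 ^ n) \<le> q (Suc n)"
      unfolding q_def power_Suc mult.assoc by (intro divide_right_mono) auto
    moreover have "(2 * real_of_int \<lceil>2 ^ n * a\<rceil> - 1 - 1) / (2 * 2 ^ n) = q n"
      by (simp add: q_def divide_simps)
    ultimately show "q n \<le> q (Suc n)" by simp
  qed
  show "\<exists>n. b < q n" if b: "b < a" for b
  proof -
    obtain n where "(1 / 2) ^ n < a - b"
      using real_arch_pow_inv[of "a - b" "1 / 2"] b by auto
    moreover have "a - (1 / 2) ^ n \<le> q n"
    proof -
      have "2 ^ n * a - 1 \<le> of_int \<lceil>2 ^ n * a\<rceil> - 1" by linarith
      then have "(2 ^ n * a - 1) / 2 ^ n \<le> q n"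
        unfolding q_def by (rule divide_right_mono) simp
      then show ?thesis by (simp add: field_simps power_divide)
    qed
    ultimately have "b < q n" by linarith
    then show ?thesis ..
  qed
qed

text \<open>
  Almost everywhere the densities are monotone in the rational \<open>q\<close> and bounded by the density 1 of
  the whole square. There the kernel of \<open>{0..<a}\<close> is their monotone limit as \<open>q\<close> increases to \<open>a\<close>,
  and \<open>\<mu> (A \<times> [0, q])\<close> converges to \<open>\<mu> (A \<times> [0, a))\<close>.
\<close>

lemma nn_integral_disintegration_lessThan:
  assumes \<mu>: "doubly_stochastic \<mu>" and A: "A \<in> sets lambdaI" and a: "0 < a" "a \<le> 1"
  shows "(\<integral>\<^sup>+ x. emeasure (disintegration \<mu> x) {0..<a} * indicator A x \<partial>lambdaI) = emeasure \<mu> (A \<times> {0..<a})"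
proof -
  let ?f = "\<lambda>q. strip_density \<mu> {0..q}"
  obtain q where q: "\<And>n. q n \<in> levels" "\<And>n. q n < a" "incseq q" "\<And>b. b < a \<Longrightarrow> \<exists>n. b < q n"
    using levels_sequence[OF a] by blast
  have mono: "AE x in lambdaI. \<forall>p\<in>levels. \<forall>r\<in>levels. p \<le> r \<longrightarrow> ?f p x \<le> ?f r x"
    unfolding AE_ball_countable[OF countable_levels]
    by (intro ballI AE_impI strip_density_mono \<mu> level_interval) auto
  have "AE x in lambdaI. emeasure (disintegration \<mu> x) {0..<a} * indicator A x
      = (SUP n. ?f (q n) x * indicator A x)"
    using mono strip_density_unit[OF \<mu>] AE_space
  proof eventually_elim
    fix x assume mono: "\<forall>p\<in>levels. \<forall>r\<in>levels. p \<le> r \<longrightarrow> ?f p x \<le> ?f r x"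
      and one: "strip_density \<mu> {0..1} x = 1" and x: "x \<in> space lambdaI"
    have eq: "(SUP p\<in>levels \<inter> {..<a}. ?f p x) = (SUP n. ?f (q n) x)"
    proof (rule antisym; rule SUP_least)
      fix p assume p: "p \<in> levels \<inter> {..<a}"
      then obtain n where "p < q n" using q(4) by auto
      then have "?f p x \<le> ?f (q n) x" using mono p q(1)[of n] by auto
      also have "\<dots> \<le> (SUP n. ?f (q n) x)" by (rule SUP_upper) simp
      finally show "?f p x \<le> (SUP n. ?f (q n) x)" .
    next
      fix n show "?f (q n) x \<le> (SUP p\<in>levels \<inter> {..<a}. ?f p x)"
        using q(1,2)[of n] by (intro SUP_upper) auto
    qed
    have "?f p x \<le> 1" if "p \<in> levels" for p
      unfolding one[symmetric] using mono that by auto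
    then have "(SUP p\<in>levels \<inter> {..<a}. ?f p x) \<le> 1"
      by (intro SUP_least) auto
    then show "emeasure (disintegration \<mu> x) {0..<a} * indicator A x = (SUP n. ?f (q n) x * indicator A x)"
      using emeasure_disintegration[OF _ a, of x \<mu>] x by (simp add: eq SUP_mult_right_ennreal)
  qed
  then have "(\<integral>\<^sup>+ x. emeasure (disintegration \<mu> x) {0..<a} * indicator A x \<partial>lambdaI)
      = (\<integral>\<^sup>+ x. (SUP n. ?f (q n) x * indicator A x) \<partial>lambdaI)"
    by (rule nn_integral_cong_AE)
  also have "\<dots> = (SUP n. \<integral>\<^sup>+ x. ?f (q n) x * indicator A x \<partial>lambdaI)"
  proof (rule nn_integral_monotone_convergence_SUP_AE)
    fix n
    show "AE x in lambdaI. ?f (q n) x * indicator A x \<le> ?f (q (Suc n)) x * indicator A x"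
      using mono
    proof eventually_elim
      fix x assume "\<forall>p\<in>levels. \<forall>r\<in>levels. p \<le> r \<longrightarrow> ?f p x \<le> ?f r x"
      then have "?f (q n) x \<le> ?f (q (Suc n)) x"
        using q(1) incseq_SucD[OF q(3)] by blast
      then show "?f (q n) x * indicator A x \<le> ?f (q (Suc n)) x * indicator A x"
        by (rule mult_right_mono) simp
    qed
  qed (use A in simp)
  also have "\<dots> = (SUP n. emeasure \<mu> (A \<times> {0..q n}))"
    using nn_integral_strip_density[OF \<mu> A level_interval[OF q(1)]] by simp
  also have "\<dots> = emeasure \<mu> (\<Union>n. A \<times> {0..q n})"
  proof (rule SUP_emeasure_incseq)
    show "range (\<lambda>n. A \<times> {0..q n}) \<subseteq> sets \<mu>"
      using A level_interval[OF q(1)] by (auto simp: doubly_stochastic_sets[OF \<mu>])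
    show "incseq (\<lambda>n. A \<times> {0..q n})"
      using incseq_SucD[OF q(3)] by (intro incseq_SucI Sigma_mono) auto
  qed
  also have "(\<Union>n. A \<times> {0..q n}) = A \<times> {0..<a}"
  proof -
    have "\<exists>n. y \<le> q n" if "y < a" for y using q(4)[OF that] by (auto intro: less_imp_le)
    moreover have "y < a" if "y \<le> q n" for y n using q(2)[of n] that by linarith
    ultimately show ?thesis by auto
  qed
  finally show ?thesis .
qed

text \<open>
  For fixed \<open>A\<close>, both sides are finite measures in \<open>E\<close>, and half-open intervals determine them.
\<close>

lemma emeasure_Times_eqI_lessThan:
  assumes s: "sets \<mu> = sets square_measure" "sets \<nu> = sets square_measure"
    and A: "A \<in> sets lambdaI"
    and fin: "emeasure \<mu> (A \<times> {0..1}) \<noteq> \<infinity>"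
    and total: "emeasure \<mu> (A \<times> {0..1}) = emeasure \<nu> (A \<times> {0..1})"
    and below: "\<And>a. 0 < a \<Longrightarrow> a \<le> 1 \<Longrightarrow> emeasure \<mu> (A \<times> {0..<a}) = emeasure \<nu> (A \<times> {0..<a})"
    and E: "E \<in> sets lambdaI"
  shows "emeasure \<mu> (A \<times> E) = emeasure \<nu> (A \<times> E)"
proof -
  define D where "D \<rho> = distr (restrict_space \<rho> (A \<times> {0..1})) lambdaI snd" for \<rho> :: "(real \<times> real) measure"
  have D: "emeasure (D \<rho>) B = emeasure \<rho> (A \<times> B)"
    if \<rho>: "sets \<rho> = sets square_measure" and B: "B \<in> sets lambdaI" for \<rho> B
  proof -
    have sp: "space \<rho> = {0..1} \<times> {0..1}"
      using sets_eq_imp_space_eq[OF \<rho>] by (simp add: space_pair_measure)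
    have AI: "A \<times> {0..1} \<in> sets \<rho>"
      unfolding \<rho> using A by (auto simp: sets_lambdaI_iff)
    have "snd \<in> \<rho> \<rightarrow>\<^sub>M lambdaI" by (simp add: measurable_cong_sets[OF \<rho> refl])
    then have m: "snd \<in> restrict_space \<rho> (A \<times> {0..1}) \<rightarrow>\<^sub>M lambdaI"
      by (rule measurable_restrict_space1)
    have "snd -` B \<inter> space (restrict_space \<rho> (A \<times> {0..1})) = A \<times> B"
      using A B by (auto simp: space_restrict_space sp sets_lambdaI_iff)
    then show ?thesis
      unfolding D_def using m A B AI
      by (simp add: emeasure_distr) (subst emeasure_restrict_space, auto simp: sets_lambdaI_iff)
  qed
  have "D \<mu> = D \<nu>"
  proof (rule measure_lambdaI_eqI_lessThan)
    show "sets (D \<mu>) = sets lambdaI" "sets (D \<nu>) = sets lambdaI" by (simp_all add: D_def)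
    have "{0..1} \<in> sets lambdaI" by (simp add: sets_lambdaI_iff)
    then show "emeasure (D \<mu>) {0..1} \<noteq> \<infinity>" "emeasure (D \<mu>) {0..1} = emeasure (D \<nu>) {0..1}"
      using fin total by (simp_all add: D s)
    show "emeasure (D \<mu>) {0..<a} = emeasure (D \<nu>) {0..<a}" if "0 < a" "a \<le> 1" for a
    proof -
      have "{0..<a} \<in> sets lambdaI" using that by (auto simp: sets_lambdaI_iff)
      then show ?thesis using below[OF that] by (simp add: D s)
    qed
  qed
  with D[OF s(1) E] D[OF s(2) E] show ?thesis by simp
qed

text \<open>
  Both measures agree on the rectangles \<open>A \<times> [0, a)\<close>, hence on all rectangles. This includes the
  marginals, so the measure of the kernel is doubly stochastic, and a doubly stochastic measure is
  determined by its copula.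
\<close>

theorem kernel_measure_disintegration:
  assumes \<mu>: "doubly_stochastic \<mu>"
  shows "kernel_measure (disintegration \<mu>) = \<mu>"
proof -
  let ?\<nu> = "kernel_measure (disintegration \<mu>)"
  have I: "{0..1} \<in> sets lambdaI" by (simp add: sets_lambdaI_iff)
  have s: "sets ?\<nu> = sets square_measure"
    by (rule sets_kernel_measure[OF disintegration_kernel])
  have total: "emeasure ?\<nu> (A \<times> {0..1}) = emeasure lambdaI A" if A: "A \<in> sets lambdaI" for A
  proof -
    have "emeasure ?\<nu> (A \<times> {0..1}) = (\<integral>\<^sup>+ x. indicator A x \<partial>lambdaI)"
      unfolding emeasure_kernel_measure_Times[OF disintegration_kernel A I]
    proof (rule nn_integral_cong)
      fix x assume "x \<in> space lambdaI"
      then have x: "x \<in> {0..1}" by simp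
      interpret prob_space "disintegration \<mu> x"
        by (rule kernelD[OF disintegration_kernel x])
      show "emeasure (disintegration \<mu> x) {0..1} * indicator A x = indicator A x"
        using emeasure_space_1 space_eq_unit[OF kernelD(2)[OF disintegration_kernel x]] by simp
    qed
    then show ?thesis using A by simp
  qed
  have rect: "emeasure ?\<nu> (A \<times> E) = emeasure \<mu> (A \<times> E)" if A: "A \<in> sets lambdaI" and E: "E \<in> sets lambdaI" for A E
  proof (rule emeasure_Times_eqI_lessThan[OF s doubly_stochastic_sets[OF \<mu>] A _ _ _ E])
    show "emeasure ?\<nu> (A \<times> {0..1}) \<noteq> \<infinity>" by (simp add: total A)
    show "emeasure ?\<nu> (A \<times> {0..1}) = emeasure \<mu> (A \<times> {0..1})"
      by (simp add: total A doubly_stochastic_fst[OF \<mu>])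
    fix a :: real assume a: "0 < a" "a \<le> 1"
    then have "{0..<a} \<in> sets lambdaI" by (auto simp: sets_lambdaI_iff)
    then show "emeasure ?\<nu> (A \<times> {0..<a}) = emeasure \<mu> (A \<times> {0..<a})"
      using emeasure_kernel_measure_Times[OF disintegration_kernel A]
        nn_integral_disintegration_lessThan[OF \<mu> A a] by simp
  qed
  have \<nu>: "doubly_stochastic ?\<nu>"
    by (rule doubly_stochasticI[OF s]) (simp_all add: rect I doubly_stochastic_fst[OF \<mu>] doubly_stochastic_snd[OF \<mu>])
  show ?thesis
    by (rule doubly_stochastic_unique[OF \<nu> \<mu>]) (simp add: measure_def rect atLeastAtMost_in_lambdaI)
qed

lemma markov_kernel_copula_kernel:
  assumes C: "C \<in> copulas"
  shows "markov_kernel C (copula_kernel C)"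
  unfolding copula_kernel_def
proof (rule someI[of "markov_kernel C"])
  show "markov_kernel C (disintegration (copula_measure C))"
    using doubly_stochastic_copula_measure[OF C] 
    by (simp add: markov_kernel_iff[OF C disintegration_kernel] kernel_measure_disintegration)
qed

section \<open>Distribution functions of kernels and uniqueness\<close>

definition kernel_cdf :: "(real \<Rightarrow> real measure) \<Rightarrow> real \<times> real \<Rightarrow> real" where
  "kernel_cdf K p = measure (K (fst p)) {0..snd p}"

abbreviation copula_cdf :: "(real \<times> real \<Rightarrow> real) \<Rightarrow> real \<times> real \<Rightarrow> real" where
  "copula_cdf C \<equiv> kernel_cdf (copula_kernel C)"

lemma kernel_cdf_measurable [measurable]:
  assumes K: "K \<in> lambdaI \<rightarrow>\<^sub>M prob_algebra lambdaI"
  shows "kernel_cdf K \<in> borel_measurable square_measure"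
proof -
  have [measurable]: "snd \<in> borel_measurable square_measure"
    using measurable_compose[OF measurable_snd id_measurable_lambdaI] by simp
  have [measurable]: "(\<lambda>q. snd q) \<in> borel_measurable (square_measure \<Otimes>\<^sub>M lambdaI)"
    using measurable_compose[OF measurable_snd id_measurable_lambdaI] by simp
  have "{q \<in> space (square_measure \<Otimes>\<^sub>M lambdaI). snd q \<le> snd (fst q)} \<in> sets (square_measure \<Otimes>\<^sub>M lambdaI)"
    by measurable
  moreover have "{q \<in> space (square_measure \<Otimes>\<^sub>M lambdaI). snd q \<le> snd (fst q)}
      = (SIGMA p:space square_measure. {0..snd p})"
    by (auto simp: space_pair_measure)
  ultimately have S: "(SIGMA p:space square_measure. {0..snd p}) \<in> sets (square_measure \<Otimes>\<^sub>M lambdaI)"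
    by simp
  have "(\<lambda>p. K (fst p)) \<in> square_measure \<rightarrow>\<^sub>M prob_algebra lambdaI"
    using measurable_compose[OF measurable_fst K] .
  from measure_measurable_prob_algebra2[OF S this] show ?thesis
    by (simp add: kernel_cdf_def[abs_def])
qed

lemma kernel_cdf_bounds:
  assumes K: "K \<in> lambdaI \<rightarrow>\<^sub>M prob_algebra lambdaI" and p: "p \<in> space square_measure"
  shows "0 \<le> kernel_cdf K p" "kernel_cdf K p \<le> 1"
proof -
  have "fst p \<in> {0..1}" using p by (auto simp: space_pair_measure)
  then interpret prob_space "K (fst p)" by (rule kernelD(1)[OF K])
  show "0 \<le> kernel_cdf K p" "kernel_cdf K p \<le> 1" by (simp_all add: kernel_cdf_def)
qed

lemma integrable_square:
  fixes f :: "real \<times> real \<Rightarrow> real"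
  assumes "f \<in> borel_measurable square_measure" and "\<And>p. p \<in> space square_measure \<Longrightarrow> \<bar>f p\<bar> \<le> B"
  shows "integrable square_measure f"
  using assms by (intro square.P.integrable_const_bound[where B = B]) auto

text \<open>
  The measure of the square fixes \<open>\<integral>\<^sub>A K x [0, y] dx\<close> for all \<open>A\<close>, hence for each \<open>y\<close> the value
  \<open>K x [0, y]\<close> for almost all \<open>x\<close>. Fubini's theorem exchanges the quantifiers: for almost all \<open>x\<close>
  the distribution functions agree at almost all \<open>y\<close>, which already forces equal measures.
\<close>

lemma kernel_measure_eq_iff_AE:
  assumes K: "K \<in> lambdaI \<rightarrow>\<^sub>M prob_algebra lambdaI" and L: "L \<in> lambdaI \<rightarrow>\<^sub>M prob_algebra lambdaI"
  shows "kernel_measure K = kernel_measure L \<longleftrightarrow> (AE x in lambdaI. K x = L x)"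
    and "kernel_measure K = kernel_measure L \<longleftrightarrow> (AE p in square_measure. kernel_cdf K p = kernel_cdf L p)"
proof -
  note [measurable] = kernel_cdf_measurable[OF K] kernel_cdf_measurable[OF L]
  have set: "{p \<in> space square_measure. kernel_cdf K p = kernel_cdf L p} \<in> sets square_measure"
    by measurable
  have 1: "AE p in square_measure. kernel_cdf K p = kernel_cdf L p" if eq: "kernel_measure K = kernel_measure L"
  proof -
    have "AE x in lambdaI. kernel_cdf K (x, y) = kernel_cdf L (x, y)" if y: "y \<in> {0..1}" for y
    proof -
      have E: "{0..y} \<in> sets lambdaI" by (rule atLeastAtMost_in_lambdaI[OF y])
      have m: "(\<lambda>x. emeasure (J x) {0..y}) \<in> borel_measurable lambdaI"
        if "J \<in> lambdaI \<rightarrow>\<^sub>M prob_algebra lambdaI" for J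
        using measurable_compose[OF measurable_prob_algebraD[OF that] measurable_emeasure_subprob_algebra[OF E]] .
      have "AE x in lambdaI. emeasure (K x) {0..y} = emeasure (L x) {0..y}"
      proof (rule lambdaI.density_unique[OF m[OF K] m[OF L]], rule measure_eqI)
        fix A assume "A \<in> sets (density lambdaI (\<lambda>x. emeasure (K x) {0..y}))"
        then have A: "A \<in> sets lambdaI" by simp
        show "emeasure (density lambdaI (\<lambda>x. emeasure (K x) {0..y})) A
            = emeasure (density lambdaI (\<lambda>x. emeasure (L x) {0..y})) A"
          using eq m[OF K] m[OF L] A emeasure_kernel_measure_Times[OF K A E] emeasure_kernel_measure_Times[OF L A E]
          by (simp add: emeasure_density)
      qed simp
      then show ?thesis by eventually_elim (simp add: kernel_cdf_def measure_def)
    qed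
    then have "AE y in lambdaI. AE x in lambdaI. kernel_cdf K (x, y) = kernel_cdf L (x, y)"
      by (rule AE_I2) simp
    then have "AE x in lambdaI. AE y in lambdaI. kernel_cdf K (x, y) = kernel_cdf L (x, y)"
      using square.AE_commute[of "\<lambda>x y. kernel_cdf K (x, y) = kernel_cdf L (x, y)"] set by simp
    then show ?thesis by (rule square.AE_pair_measure[OF set])
  qed
  have 2: "AE x in lambdaI. K x = L x" if "AE p in square_measure. kernel_cdf K p = kernel_cdf L p"
    using square.AE_pair[OF that] AE_space
  proof eventually_elim
    fix x assume ae: "AE y in lambdaI. kernel_cdf K (x, y) = kernel_cdf L (x, y)" and x: "x \<in> space lambdaI"
    then have x: "x \<in> {0..1}" by simp
    show "K x = L x"
      using ae by (intro measure_lambdaI_eqI_AE kernelD[OF K x] kernelD[OF L x]) (simp add: kernel_cdf_def)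
  qed
  have 3: "kernel_measure K = kernel_measure L" if "AE x in lambdaI. K x = L x"
  proof (rule measure_eqI)
    fix G assume "G \<in> sets (kernel_measure K)"
    then have "G \<in> sets square_measure" by (simp add: sets_kernel_measure[OF K])
    then show "emeasure (kernel_measure K) G = emeasure (kernel_measure L) G"
      using that by (auto simp: emeasure_kernel_measure K L intro!: nn_integral_cong_AE elim: eventually_mono)
  qed (simp add: sets_kernel_measure K L)
  show "kernel_measure K = kernel_measure L \<longleftrightarrow> (AE x in lambdaI. K x = L x)"
    and "kernel_measure K = kernel_measure L \<longleftrightarrow> (AE p in square_measure. kernel_cdf K p = kernel_cdf L p)"
    using 1 2 3 by blast+
qed

lemma copula_kernel_measurable:
  "C \<in> copulas \<Longrightarrow> copula_kernel C \<in> lambdaI \<rightarrow>\<^sub>M prob_algebra lambdaI"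
  using markov_kernel_copula_kernel by (simp add: markov_kernel_def)

lemma kernel_measure_copula_kernel:
  "C \<in> copulas \<Longrightarrow> kernel_measure (copula_kernel C) = copula_measure C"
  using markov_kernel_copula_kernel markov_kernel_iff copula_kernel_measurable by metis

lemmas copula_cdf_measurable [measurable] = kernel_cdf_measurable[OF copula_kernel_measurable]
lemmas copula_cdf_bounds = kernel_cdf_bounds[OF copula_kernel_measurable]

lemma copula_cdf_AE_eq:
  assumes C: "C \<in> copulas" and K: "markov_kernel C K"
  shows "AE p in square_measure. copula_cdf C p = kernel_cdf K p"
proof -
  have m: "K \<in> lambdaI \<rightarrow>\<^sub>M prob_algebra lambdaI" using K by (simp add: markov_kernel_def)
  have "kernel_measure (copula_kernel C) = kernel_measure K"
    using K by (simp add: kernel_measure_copula_kernel C markov_kernel_iff[OF C m])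
  then show ?thesis
    using kernel_measure_eq_iff_AE(2)[OF copula_kernel_measurable[OF C] m] by simp
qed

section \<open>The metric\<close>

lemma copula_cdf_diff_bound:
  assumes "C1 \<in> copulas" "C2 \<in> copulas" "p \<in> space square_measure"
  shows "\<bar>copula_cdf C1 p - copula_cdf C2 p\<bar> \<le> 1"
  using copula_cdf_bounds[OF assms(1,3)] copula_cdf_bounds[OF assms(2,3)] by linarith

lemma integrable_copula_cdf_diff:
  assumes "C1 \<in> copulas" "C2 \<in> copulas"
  shows "integrable square_measure (\<lambda>p. \<bar>copula_cdf C1 p - copula_cdf C2 p\<bar>)"
  using assms by (intro integrable_square[where B = 1]) (auto simp: copula_cdf_diff_bound)

lemma D1_eq_integral:
  assumes "C1 \<in> copulas" "C2 \<in> copulas"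
  shows "D1 C1 C2 = (\<integral>p. \<bar>copula_cdf C1 p - copula_cdf C2 p\<bar> \<partial>square_measure)"
proof -
  have "(\<lambda>(x, y). \<bar>copula_cdf C1 (x, y) - copula_cdf C2 (x, y)\<bar>) = (\<lambda>p. \<bar>copula_cdf C1 p - copula_cdf C2 p\<bar>)"
    by auto
  then have "integrable square_measure (\<lambda>(x, y). \<bar>copula_cdf C1 (x, y) - copula_cdf C2 (x, y)\<bar>)"
    using integrable_copula_cdf_diff[OF assms] by simp
  from square.integral_snd[OF this] show ?thesis
    by (simp add: D1_def kernel_cdf_def split_beta')
qed

theorem Metric_space_D1: "Metric_space copulas D1"
proof
  fix C1 C2 C3
  show "0 \<le> D1 C1 C2"
    unfolding D1_def by (intro integral_nonneg_AE AE_I2) (simp add: integral_nonneg_AE)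
  show "D1 C1 C2 = D1 C2 C1"
    unfolding D1_def by (simp add: abs_minus_commute)
  assume 1: "C1 \<in> copulas" and 2: "C2 \<in> copulas"
  have "D1 C1 C2 = 0 \<longleftrightarrow> (AE p in square_measure. copula_cdf C1 p = copula_cdf C2 p)"
    unfolding D1_eq_integral[OF 1 2]
    by (subst integral_nonneg_eq_0_iff_AE[OF integrable_copula_cdf_diff[OF 1 2]]) auto
  also have "\<dots> \<longleftrightarrow> copula_measure C1 = copula_measure C2"
    using kernel_measure_eq_iff_AE(2)[OF copula_kernel_measurable[OF 1] copula_kernel_measurable[OF 2]]
    by (simp add: kernel_measure_copula_kernel 1 2)
  also have "\<dots> \<longleftrightarrow> C1 = C2"
    using copula_of_copula_measure[OF 1] copula_of_copula_measure[OF 2] by metis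
  finally show "D1 C1 C2 = 0 \<longleftrightarrow> C1 = C2" .
  assume 3: "C3 \<in> copulas"
  have "D1 C1 C3 \<le> (\<integral>p. \<bar>copula_cdf C1 p - copula_cdf C2 p\<bar> + \<bar>copula_cdf C2 p - copula_cdf C3 p\<bar> \<partial>square_measure)"
    unfolding D1_eq_integral[OF 1 3]
    by (intro integral_mono integrable_copula_cdf_diff Bochner_Integration.integrable_add 1 2 3) auto
  also have "\<dots> = D1 C1 C2 + D1 C2 C3"
    by (simp add: D1_eq_integral 1 2 3 integrable_copula_cdf_diff)
  finally show "D1 C1 C3 \<le> D1 C1 C2 + D1 C2 C3" .
qed

section \<open>Complete dependence as vanishing spread\<close>

lemma AE_lambdaI_neq: "AE y in lambdaI. y \<noteq> c"
proof (rule AE_I[where N = "{c} \<inter> {0..1}"])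
  have "{c} \<inter> {0..1} \<in> sets lambdaI" by (auto simp: sets_lambdaI_iff)
  moreover have "emeasure lborel ({c} \<inter> {0..1}) \<le> emeasure lborel {c}" by (rule emeasure_mono) auto
  then have "emeasure lborel ({c} \<inter> {0..1}) = 0" by simp
  ultimately show "emeasure lambdaI ({c} \<inter> {0..1}) = 0" by (simp only: emeasure_lambdaI)
  show "{c} \<inter> {0..1} \<in> sets lambdaI" by fact
qed auto

text \<open>
  \<open>r (1 - r)\<close> is the variance of the Bernoulli law with mean \<open>r\<close>, so this measures how far the
  kernel is from being deterministic.
\<close>

definition spread :: "(real \<times> real \<Rightarrow> real) \<Rightarrow> real" where
  "spread C = (\<integral>p. copula_cdf C p * (1 - copula_cdf C p) \<partial>square_measure)"

lemma spread_integrand_bounds: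
  assumes "C \<in> copulas" "p \<in> space square_measure"
  shows "0 \<le> copula_cdf C p * (1 - copula_cdf C p)" "copula_cdf C p * (1 - copula_cdf C p) \<le> 1"
  using copula_cdf_bounds[OF assms] by (auto intro: mult_le_one)

lemma integrable_spread:
  assumes "C \<in> copulas"
  shows "integrable square_measure (\<lambda>p. copula_cdf C p * (1 - copula_cdf C p))"
  using assms spread_integrand_bounds[OF assms] by (intro integrable_square[where B = 1]) auto

lemma spread_eq_0_iff:
  assumes C: "C \<in> copulas"
  shows "spread C = 0 \<longleftrightarrow> (AE p in square_measure. copula_cdf C p \<in> {0, 1})"
proof -
  have "spread C = 0 \<longleftrightarrow> (AE p in square_measure. copula_cdf C p * (1 - copula_cdf C p) = 0)"
    unfolding spread_def
    by (rule integral_nonneg_eq_0_iff_AE[OF integrable_spread[OF C]])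
      (rule AE_I2, rule spread_integrand_bounds[OF C])
  then show ?thesis by simp
qed

lemma spread_nonneg: "C \<in> copulas \<Longrightarrow> 0 \<le> spread C"
  unfolding spread_def by (rule integral_nonneg_AE, rule AE_I2, rule spread_integrand_bounds)

text \<open>
  Since \<open>a (1 - a) - b (1 - b) = (a - b) (1 - a - b)\<close> and \<open>\<bar>1 - a - b\<bar> \<le> 1\<close> on the unit interval.
\<close>

lemma spread_Lipschitz:
  assumes C: "C \<in> copulas" "C' \<in> copulas"
  shows "spread C - spread C' \<le> D1 C C'"
proof -
  let ?F = "copula_cdf C" and ?G = "copula_cdf C'"
  have "spread C - spread C' = (\<integral>p. ?F p * (1 - ?F p) - ?G p * (1 - ?G p) \<partial>square_measure)"
    unfolding spread_def by (simp add: integrable_spread C)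
  also have "\<dots> \<le> (\<integral>p. \<bar>?F p - ?G p\<bar> \<partial>square_measure)"
  proof (intro integral_mono integrable_copula_cdf_diff Bochner_Integration.integrable_diff integrable_spread C)
    fix p assume p: "p \<in> space square_measure"
    have "?F p * (1 - ?F p) - ?G p * (1 - ?G p) = (?F p - ?G p) * (1 - ?F p - ?G p)"
      by (simp add: algebra_simps)
    also have "\<dots> \<le> \<bar>?F p - ?G p\<bar> * \<bar>1 - ?F p - ?G p\<bar>"
      by (metis abs_ge_self abs_mult)
    also have "\<dots> \<le> \<bar>?F p - ?G p\<bar> * 1"
      using copula_cdf_bounds[OF C(1) p] copula_cdf_bounds[OF C(2) p] by (intro mult_left_mono) auto
    finally show "?F p * (1 - ?F p) - ?G p * (1 - ?G p) \<le> \<bar>?F p - ?G p\<bar>" by simp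
  qed
  also have "\<dots> = D1 C C'" by (rule D1_eq_integral[OF C, symmetric])
  finally show ?thesis .
qed

text \<open>
  A monotone function with values 0 and 1 jumps once, at some \<open>c\<close>, so the measure sits at \<open>c\<close>. The
  jump is expressed by the integral of the distribution function because this, unlike the infimum
  defining \<open>c\<close>, is visibly measurable in a parameter.
\<close>

lemma zero_one_valued_imp_dirac:
  assumes s: "sets M = sets lambdaI" and "prob_space M"
    and ae: "AE y in lambdaI. measure M {0..y} \<in> {0, 1}"
  shows "M = return lambdaI (1 - (\<integral>y. measure M {0..y} \<partial>lambdaI))"
proof -
  interpret M: prob_space M by fact
  define S where "S = {y \<in> {0..1}. measure M {0..y} = 1}"
  have one: "1 \<in> S"
    using M.prob_space space_eq_unit[OF s] by (simp add: S_def)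
  have bdd: "bdd_below S" by (auto simp: S_def intro!: bdd_belowI[of _ 0])
  define c where "c = Inf S"
  have c: "0 \<le> c" "c \<le> 1"
    unfolding c_def using one bdd by (auto intro!: cInf_greatest cInf_lower simp: S_def)
  have cdf: "AE y in lambdaI. measure M {0..y} = indicator {c..1} y"
    using ae AE_lambdaI_neq[of c] AE_space
  proof eventually_elim
    fix y assume y: "measure M {0..y} \<in> {0, 1}" "y \<noteq> c" "y \<in> space lambdaI"
    show "measure M {0..y} = indicator {c..1} y"
    proof (cases "y < c")
      case True
      then have "y \<notin> S" using cInf_lower[OF _ bdd, of y] by (auto simp: c_def)
      then show ?thesis using y True by (auto simp: S_def)
    next
      case False
      then have "Inf S < y" using y by (simp add: c_def)
      then obtain z where z: "z \<in> S" "z < y"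
        using one bdd by (subst (asm) cInf_less_iff) auto
      have "1 = measure M {0..z}" using z by (simp add: S_def)
      also have "\<dots> \<le> measure M {0..y}"
        using z y by (intro M.finite_measure_mono) (auto simp: s sets_lambdaI_iff)
      finally show ?thesis using M.prob_le_1[of "{0..y}"] y False by auto
    qed
  qed
  have ci: "{c..1} \<in> sets lambdaI" using c by (auto simp: sets_lambdaI_iff)
  \<comment> \<open>measurability of a distribution function, as that of the constant kernel \<open>M\<close>\<close>
  have [measurable]: "(\<lambda>y. measure M {0..y}) \<in> borel_measurable lambdaI"
    using measurable_Pair2[OF kernel_cdf_measurable[of "\<lambda>_. M"], of 0] s M.prob_space_axioms
    by (simp add: kernel_cdf_def space_prob_algebra)
  have "(\<integral>y. measure M {0..y} \<partial>lambdaI) = (\<integral>y. indicator {c..1} y \<partial>lambdaI)"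
    using cdf ci by (intro integral_cong_AE) auto
  also have "\<dots> = 1 - c"
    using c ci by (simp add: measure_def emeasure_lambdaI)
  finally have mean: "1 - (\<integral>y. measure M {0..y} \<partial>lambdaI) = c" by simp
  have "M = return lambdaI c"
  proof (rule measure_lambdaI_eqI_AE[OF s])
    show "prob_space (return lambdaI c)" using c by (intro prob_space_return) simp
    show "AE y in lambdaI. measure M {0..y} = measure (return lambdaI c) {0..y}"
      using cdf AE_space
    proof eventually_elim
      fix y assume "measure M {0..y} = indicator {c..1} y" "y \<in> space lambdaI"
      then show "measure M {0..y} = measure (return lambdaI c) {0..y}"
        using c atLeastAtMost_in_lambdaI[of y] by (simp add: measure_return indicator_def)
    qed
  qed (use assms in simp_all)
  then show ?thesis unfolding mean .
qed

text \<open>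
  That \<open>h\<close> preserves Lebesgue measure is just the second marginal condition on the copula measure.
\<close>

lemma lambda_preserving_of_markov_kernel:
  assumes C: "C \<in> copulas" and h: "h \<in> lambdaI \<rightarrow>\<^sub>M lambdaI"
    and K: "markov_kernel C (\<lambda>x. return lambdaI (h x))"
  shows "lambda_preserving h"
  unfolding lambda_preserving_def
proof (intro conjI h ballI)
  fix E assume E: "E \<in> sets lambdaI"
  have m: "(\<lambda>x. return lambdaI (h x)) \<in> lambdaI \<rightarrow>\<^sub>M prob_algebra lambdaI"
    using K by (simp add: markov_kernel_def)
  have I: "{0..1} \<in> sets lambdaI" by (simp add: sets_lambdaI_iff)
  have hE: "h -` E \<inter> {0..1} \<in> sets lambdaI" using measurable_sets[OF h E] by simp
  have "emeasure lambdaI E = emeasure (copula_measure C) ({0..1} \<times> E)"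
    by (rule doubly_stochastic_snd[OF doubly_stochastic_copula_measure[OF C] E, symmetric])
  also have "\<dots> = (\<integral>\<^sup>+ x. emeasure (return lambdaI (h x)) E * indicator {0..1} x \<partial>lambdaI)"
    using K markov_kernel_iff[OF C m] emeasure_kernel_measure_Times[OF m I E] by simp
  also have "\<dots> = (\<integral>\<^sup>+ x. indicator (h -` E \<inter> {0..1}) x \<partial>lambdaI)"
    using E by (intro nn_integral_cong) (simp add: indicator_def)
  also have "\<dots> = emeasure lambdaI (h -` E \<inter> {0..1})"
    using hE by simp
  finally show "emeasure lambdaI (h -` E \<inter> {0..1}) = emeasure lambdaI E" ..
qed

text \<open>
  The map \<open>h\<close> of a copula without spread sends \<open>x\<close> to the mean of its kernel at \<open>x\<close>, which is
  \<open>1 - \<integral> F (x, y) dy\<close>; almost everywhere the kernel is concentrated at this point.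
\<close>

theorem cd_copulas_iff_spread:
  assumes C: "C \<in> copulas"
  shows "C \<in> cd_copulas \<longleftrightarrow> spread C = 0"
  unfolding spread_eq_0_iff[OF C]
proof
  assume "C \<in> cd_copulas"
  then obtain h where "markov_kernel C (\<lambda>x. return lambdaI (h x))"
    by (auto simp: cd_copulas_def)
  from copula_cdf_AE_eq[OF C this] AE_space
  show "AE p in square_measure. copula_cdf C p \<in> {0, 1}"
  proof eventually_elim
    fix p assume "copula_cdf C p = kernel_cdf (\<lambda>x. return lambdaI (h x)) p" "p \<in> space square_measure"
    then show "copula_cdf C p \<in> {0, 1}"
      using atLeastAtMost_in_lambdaI[of "snd p"]
      by (auto simp: kernel_cdf_def space_pair_measure measure_return indicator_def)
  qed
next
  assume ae: "AE p in square_measure. copula_cdf C p \<in> {0, 1}"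
  let ?K = "copula_kernel C"
  note K = copula_kernel_measurable[OF C]
  define h where "h x = 1 - (\<integral>y. copula_cdf C (x, y) \<partial>lambdaI)" for x
  have "h x \<in> {0..1}" if "x \<in> {0..1}" for x
  proof -
    have b: "0 \<le> copula_cdf C (x, y)" "copula_cdf C (x, y) \<le> 1" if "y \<in> space lambdaI" for y
      using copula_cdf_bounds[OF C, of "(x, y)"] that \<open>x \<in> {0..1}\<close> by (auto simp: space_pair_measure)
    have "0 \<le> (\<integral>y. copula_cdf C (x, y) \<partial>lambdaI)"
      by (rule integral_nonneg_AE) (use b in auto)
    moreover have "(\<integral>y. copula_cdf C (x, y) \<partial>lambdaI) \<le> 1"
      by (rule lambdaI.integral_le_const)
        (use b that measurable_Pair2[OF copula_cdf_measurable[OF C], of x] in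
          \<open>auto intro!: lambdaI.integrable_const_bound[where B = 1]\<close>)
    ultimately show ?thesis by (simp add: h_def)
  qed
  moreover have "h \<in> borel_measurable lambdaI"
    unfolding h_def[abs_def] using C by measurable
  ultimately have h: "h \<in> lambdaI \<rightarrow>\<^sub>M lambdaI" by (auto simp: measurable_lambdaI_iff)
  then have m: "(\<lambda>x. return lambdaI (h x)) \<in> lambdaI \<rightarrow>\<^sub>M prob_algebra lambdaI"
    by (rule measurable_compose[OF _ measurable_return_prob_space])
  have "AE x in lambdaI. ?K x = return lambdaI (h x)"
    using square.AE_pair[OF ae] AE_space
  proof eventually_elim
    fix x assume ae: "AE y in lambdaI. copula_cdf C (x, y) \<in> {0, 1}" and "x \<in> space lambdaI"
    then have x: "x \<in> {0..1}" by simp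
    show "?K x = return lambdaI (h x)"
      using zero_one_valued_imp_dirac[OF kernelD(2,1)[OF K x]] ae
      by (simp add: h_def kernel_cdf_def)
  qed
  then have "kernel_measure ?K = kernel_measure (\<lambda>x. return lambdaI (h x))"
    using kernel_measure_eq_iff_AE(1)[OF K m] by simp
  then have mk: "markov_kernel C (\<lambda>x. return lambdaI (h x))"
    by (simp add: markov_kernel_iff[OF C m] kernel_measure_copula_kernel[OF C])
  then show "C \<in> cd_copulas"
    using C lambda_preserving_of_markov_kernel[OF C h] by (auto simp: cd_copulas_def)
qed

section \<open>Blending with the independence copula\<close>

text \<open>
  The mixture \<open>t \<lambda> + (1 - t) K x\<close>, realised as the law of a two-stage experiment. This form yields
  its measurability in \<open>x\<close> from the monad of probability measures.
\<close>

definition blend_kernel :: "real \<Rightarrow> (real \<Rightarrow> real measure) \<Rightarrow> real \<Rightarrow> real measure" where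
  "blend_kernel t K x = measure_pmf (bernoulli_pmf t) \<bind> (\<lambda>b. if b then lambdaI else K x)"

lemma bernoulli_in_prob_algebra: "measure_pmf (bernoulli_pmf t) \<in> space (prob_algebra (count_space UNIV))"
  by (simp add: space_prob_algebra prob_space_measure_pmf)

lemma lambdaI_in_prob_algebra: "lambdaI \<in> space (prob_algebra lambdaI)"
  by (simp add: space_prob_algebra lambdaI.prob_space_axioms)

lemma blend_kernel_measurable:
  assumes K: "K \<in> lambdaI \<rightarrow>\<^sub>M prob_algebra lambdaI"
  shows "blend_kernel t K \<in> lambdaI \<rightarrow>\<^sub>M prob_algebra lambdaI"
  unfolding blend_kernel_def[abs_def]
proof (rule measurable_bind_prob_space2)
  show "(\<lambda>x. measure_pmf (bernoulli_pmf t)) \<in> lambdaI \<rightarrow>\<^sub>M prob_algebra (count_space UNIV)"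
    using bernoulli_in_prob_algebra by simp
  note [measurable] = K
  have [measurable]: "(\<lambda>_. lambdaI) \<in> lambdaI \<Otimes>\<^sub>M count_space (UNIV :: bool set) \<rightarrow>\<^sub>M prob_algebra lambdaI"
    using lambdaI_in_prob_algebra by simp
  show "(\<lambda>(x, b). if b then lambdaI else K x) \<in> lambdaI \<Otimes>\<^sub>M count_space UNIV \<rightarrow>\<^sub>M prob_algebra lambdaI"
    unfolding split_beta' by measurable
qed

lemma emeasure_blend_kernel:
  assumes K: "K \<in> lambdaI \<rightarrow>\<^sub>M prob_algebra lambdaI" and t: "0 \<le> t" "t \<le> 1"
    and x: "x \<in> {0..1}" and E: "E \<in> sets lambdaI"
  shows "emeasure (blend_kernel t K x) E = emeasure lambdaI E * ennreal t + emeasure (K x) E * ennreal (1 - t)"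
proof -
  have "K x \<in> space (prob_algebra lambdaI)" using measurable_space[OF K] x by simp
  then have "(\<lambda>b. if b then lambdaI else K x) \<in> count_space UNIV \<rightarrow>\<^sub>M prob_algebra lambdaI"
    using lambdaI_in_prob_algebra by simp
  from emeasure_bind_prob_algebra[OF bernoulli_in_prob_algebra this E] show ?thesis
    using t by (simp add: blend_kernel_def)
qed

lemma emeasure_blend_kernel_measure_Times:
  assumes K: "K \<in> lambdaI \<rightarrow>\<^sub>M prob_algebra lambdaI" and t: "0 \<le> t" "t \<le> 1"
    and A: "A \<in> sets lambdaI" and E: "E \<in> sets lambdaI"
  shows "emeasure (kernel_measure (blend_kernel t K)) (A \<times> E) =
    emeasure lambdaI E * ennreal t * emeasure lambdaI A + ennreal (1 - t) * emeasure (kernel_measure K) (A \<times> E)"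
proof -
  have m [measurable]: "(\<lambda>x. emeasure (K x) E) \<in> borel_measurable lambdaI"
    using measurable_compose[OF measurable_prob_algebraD[OF K] measurable_emeasure_subprob_algebra[OF E]] .
  have "emeasure (kernel_measure (blend_kernel t K)) (A \<times> E) =
      (\<integral>\<^sup>+ x. emeasure lambdaI E * ennreal t * indicator A x + ennreal (1 - t) * (emeasure (K x) E * indicator A x) \<partial>lambdaI)"
    unfolding emeasure_kernel_measure_Times[OF blend_kernel_measurable[OF K] A E]
    by (intro nn_integral_cong) (simp add: emeasure_blend_kernel[OF K t _ E] algebra_simps)
  also have "\<dots> = emeasure lambdaI E * ennreal t * emeasure lambdaI A
      + ennreal (1 - t) * (\<integral>\<^sup>+ x. emeasure (K x) E * indicator A x \<partial>lambdaI)"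
    using A by (simp add: nn_integral_add nn_integral_cmult)
  finally show ?thesis by (simp add: emeasure_kernel_measure_Times[OF K A E])
qed

lemma doubly_stochastic_blend:
  assumes K: "K \<in> lambdaI \<rightarrow>\<^sub>M prob_algebra lambdaI" and t: "0 \<le> t" "t \<le> 1"
    and \<mu>: "doubly_stochastic (kernel_measure K)"
  shows "doubly_stochastic (kernel_measure (blend_kernel t K))"
proof (rule doubly_stochasticI)
  have I: "{0..1} \<in> sets lambdaI" by (simp add: sets_lambdaI_iff)
  have unit: "emeasure lambdaI {0..1} = 1" using lambdaI.emeasure_space_1 by simp
  have sum: "ennreal t * c + ennreal (1 - t) * c = c" for c
    using t by (simp add: distrib_right[symmetric] ennreal_plus[symmetric] del: ennreal_plus)
  show "sets (kernel_measure (blend_kernel t K)) = sets square_measure"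
    by (rule sets_kernel_measure[OF blend_kernel_measurable[OF K]])
  fix A assume A: "A \<in> sets lambdaI"
  show "emeasure (kernel_measure (blend_kernel t K)) (A \<times> {0..1}) = emeasure lambdaI A"
    using sum by (simp add: emeasure_blend_kernel_measure_Times[OF K t A I] doubly_stochastic_fst[OF \<mu> A] unit)
  show "emeasure (kernel_measure (blend_kernel t K)) ({0..1} \<times> A) = emeasure lambdaI A"
    using sum[of "emeasure lambdaI A"]
    by (simp add: emeasure_blend_kernel_measure_Times[OF K t I A] doubly_stochastic_snd[OF \<mu> A] unit mult.commute)
qed

text \<open>
  The copula \<open>(1 - t) C + t \<Pi>\<close>, given by its kernel rather than by this formula: the metric and the
  notion of complete dependence only see the kernel.
\<close>

definition blend :: "real \<Rightarrow> (real \<times> real \<Rightarrow> real) \<Rightarrow> real \<times> real \<Rightarrow> real" where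
  "blend t C = copula_of (kernel_measure (blend_kernel t (copula_kernel C)))"

lemma
  assumes C: "C \<in> copulas" and t: "0 \<le> t" "t \<le> 1"
  shows blend_in_copulas: "blend t C \<in> copulas"
    and copula_cdf_blend:
      "AE p in square_measure. copula_cdf (blend t C) p = t * snd p + (1 - t) * copula_cdf C p"
proof -
  note K = copula_kernel_measurable[OF C]
  note B = blend_kernel_measurable[OF K, of t]
  have ds: "doubly_stochastic (kernel_measure (blend_kernel t (copula_kernel C)))"
    by (rule doubly_stochastic_blend[OF K t])
      (simp add: kernel_measure_copula_kernel[OF C] doubly_stochastic_copula_measure[OF C])
  then show b: "blend t C \<in> copulas"
    unfolding blend_def by (rule copula_of_in_copulas)
  have "markov_kernel (blend t C) (blend_kernel t (copula_kernel C))"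
    unfolding markov_kernel_iff[OF b B] by (simp add: blend_def copula_measure_copula_of[OF ds])
  from copula_cdf_AE_eq[OF b this] AE_space
  show "AE p in square_measure. copula_cdf (blend t C) p = t * snd p + (1 - t) * copula_cdf C p"
  proof eventually_elim
    fix p assume eq: "copula_cdf (blend t C) p = kernel_cdf (blend_kernel t (copula_kernel C)) p"
      and p: "p \<in> space square_measure"
    then have x: "fst p \<in> {0..1}" and y: "snd p \<in> {0..1}" by (auto simp: space_pair_measure)
    note E = atLeastAtMost_in_lambdaI[OF y]
    interpret k: prob_space "copula_kernel C (fst p)" by (rule kernelD(1)[OF K x])
    have "emeasure (blend_kernel t (copula_kernel C) (fst p)) {0..snd p}
      = ennreal (t * snd p + (1 - t) * copula_cdf C p)"
      unfolding emeasure_blend_kernel[OF K t x E]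
      using t y by (simp add: lambdaI.emeasure_eq_measure k.emeasure_eq_measure kernel_cdf_def
        measure_lambdaI_atLeastAtMost ennreal_mult[symmetric] ennreal_plus[symmetric] mult.commute del: ennreal_plus)
    then show "copula_cdf (blend t C) p = t * snd p + (1 - t) * copula_cdf C p"
      using t y copula_cdf_bounds[OF C p]
      by (simp only: eq kernel_cdf_def[of "blend_kernel t (copula_kernel C)"] measure_def enn2real_ennreal
          add_nonneg_nonneg mult_nonneg_nonneg diff_ge_0_iff_ge atLeastAtMost_iff)
  qed
qed

lemma D1_blend_le:
  assumes C: "C \<in> copulas" and t: "0 \<le> t" "t \<le> 1"
  shows "D1 C (blend t C) \<le> t"
proof -
  note b = blend_in_copulas[OF C t]
  have "D1 C (blend t C) = (\<integral>p. \<bar>copula_cdf C p - copula_cdf (blend t C) p\<bar> \<partial>square_measure)"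
    by (rule D1_eq_integral[OF C b])
  also have "\<dots> \<le> t"
  proof (rule square.P.integral_le_const[OF integrable_copula_cdf_diff[OF C b]])
    show "AE p in square_measure. \<bar>copula_cdf C p - copula_cdf (blend t C) p\<bar> \<le> t"
      using copula_cdf_blend[OF C t] AE_space
    proof eventually_elim
      fix p assume eq: "copula_cdf (blend t C) p = t * snd p + (1 - t) * copula_cdf C p"
        and p: "p \<in> space square_measure"
      have "copula_cdf C p - copula_cdf (blend t C) p = t * (copula_cdf C p - snd p)"
        by (simp add: eq algebra_simps)
      moreover have "\<bar>copula_cdf C p - snd p\<bar> \<le> 1"
        using p copula_cdf_bounds[OF C p] by (auto simp: space_pair_measure)
      ultimately show "\<bar>copula_cdf C p - copula_cdf (blend t C) p\<bar> \<le> t"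
        using t by (simp add: abs_mult mult_left_le)
    qed
  qed
  finally show ?thesis .
qed

lemma D1_blend_blend_le:
  assumes C: "C \<in> copulas" "C' \<in> copulas" and t: "0 \<le> t" "t \<le> 1" "0 \<le> t'" "t' \<le> 1"
  shows "D1 (blend t C) (blend t' C') \<le> D1 C C' + \<bar>t - t'\<bar>"
proof -
  note b = blend_in_copulas[OF C(1) t(1,2)] blend_in_copulas[OF C(2) t(3,4)]
  have "D1 (blend t C) (blend t' C') = (\<integral>p. \<bar>copula_cdf (blend t C) p - copula_cdf (blend t' C') p\<bar> \<partial>square_measure)"
    by (rule D1_eq_integral[OF b])
  also have "\<dots> \<le> (\<integral>p. \<bar>copula_cdf C p - copula_cdf C' p\<bar> + \<bar>t - t'\<bar> \<partial>square_measure)"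
  proof (rule integral_mono_AE)
    show "AE p in square_measure. \<bar>copula_cdf (blend t C) p - copula_cdf (blend t' C') p\<bar>
        \<le> \<bar>copula_cdf C p - copula_cdf C' p\<bar> + \<bar>t - t'\<bar>"
      using copula_cdf_blend[OF C(1) t(1,2)] copula_cdf_blend[OF C(2) t(3,4)] AE_space
    proof eventually_elim
      fix p assume eq: "copula_cdf (blend t C) p = t * snd p + (1 - t) * copula_cdf C p"
        "copula_cdf (blend t' C') p = t' * snd p + (1 - t') * copula_cdf C' p"
        and p: "p \<in> space square_measure"
      have "copula_cdf (blend t C) p - copula_cdf (blend t' C') p
          = (1 - t) * (copula_cdf C p - copula_cdf C' p) + (t - t') * (snd p - copula_cdf C' p)"
        by (simp add: eq algebra_simps)
      also have "\<bar>\<dots>\<bar> \<le> \<bar>(1 - t) * (copula_cdf C p - copula_cdf C' p)\<bar> + \<bar>(t - t') * (snd p - copula_cdf C' p)\<bar>"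
        by (rule abs_triangle_ineq)
      also have "\<dots> \<le> \<bar>copula_cdf C p - copula_cdf C' p\<bar> + \<bar>t - t'\<bar>"
      proof (rule add_mono)
        show "\<bar>(1 - t) * (copula_cdf C p - copula_cdf C' p)\<bar> \<le> \<bar>copula_cdf C p - copula_cdf C' p\<bar>"
          using t by (simp add: abs_mult mult_left_le_one_le)
        have "\<bar>snd p - copula_cdf C' p\<bar> \<le> 1"
          using p copula_cdf_bounds[OF C(2) p] by (auto simp: space_pair_measure)
        then show "\<bar>(t - t') * (snd p - copula_cdf C' p)\<bar> \<le> \<bar>t - t'\<bar>"
          by (simp add: abs_mult mult_left_le)
      qed
      finally show "\<bar>copula_cdf (blend t C) p - copula_cdf (blend t' C') p\<bar>
        \<le> \<bar>copula_cdf C p - copula_cdf C' p\<bar> + \<bar>t - t'\<bar>" .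
    qed
  qed (use b C in \<open>auto intro!: integrable_copula_cdf_diff Bochner_Integration.integrable_add\<close>)
  also have "\<dots> = D1 C C' + \<bar>t - t'\<bar>"
    by (simp add: integrable_copula_cdf_diff C D1_eq_integral square.P.prob_space)
  finally show ?thesis .
qed

text \<open>
  The distribution function of the blend at \<open>y\<close> lies between \<open>t y\<close> and \<open>1 - t (1 - y)\<close>, so it takes
  neither the value 0 nor the value 1 when \<open>0 < y < 1\<close>.
\<close>

lemma blend_notin_cd_copulas:
  assumes C: "C \<in> copulas" and t: "0 < t" "t \<le> 1"
  shows "blend t C \<notin> cd_copulas"
proof
  have t': "0 \<le> t" "t \<le> 1" using t by simp_all
  note b = blend_in_copulas[OF C t']
  assume "blend t C \<in> cd_copulas"
  then have ae: "AE p in square_measure. copula_cdf (blend t C) p \<in> {0, 1}"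
    by (simp add: cd_copulas_iff_spread[OF b] spread_eq_0_iff[OF b])
  have [measurable]: "snd \<in> borel_measurable square_measure"
    using measurable_compose[OF measurable_snd id_measurable_lambdaI] by simp
  have "AE x in lambdaI. AE y in lambdaI. snd (x, y) \<noteq> 0 \<and> snd (x, y) \<noteq> (1::real)"
    using AE_lambdaI_neq[of 0] AE_lambdaI_neq[of 1] by (auto intro!: AE_I2)
  then have "AE p in square_measure. snd p \<noteq> 0 \<and> snd p \<noteq> 1"
    by (rule square.AE_pair_measure[rotated]) measurable
  then have "AE p in square_measure. False"
    using ae copula_cdf_blend[OF C t'] AE_space
  proof eventually_elim
    fix p assume p: "snd p \<noteq> 0 \<and> snd p \<noteq> 1" "p \<in> space square_measure"
      and val: "copula_cdf (blend t C) p \<in> {0, 1}"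
        "copula_cdf (blend t C) p = t * snd p + (1 - t) * copula_cdf C p"
    have y: "0 < snd p" "snd p < 1" using p by (auto simp: space_pair_measure)
    have "0 < t * snd p" "0 < t * (1 - snd p)" using t y by simp_all
    moreover have "0 \<le> (1 - t) * copula_cdf C p" "(1 - t) * copula_cdf C p \<le> 1 - t"
      using copula_cdf_bounds[OF C p(2)] t by (simp_all add: mult_left_le)
    ultimately show False using val by (auto simp: algebra_simps)
  qed
  then show False by simp
qed

section \<open>The completely dependent copulas form a Z-set\<close>

theorem theorem4p5:
  shows "Metric_space copulas D1 \<and> Metric_space.Z_set copulas D1 cd_copulas"
proof
  show "Metric_space copulas D1" by (rule Metric_space_D1)
  interpret Metric_space copulas D1 by (rule Metric_space_D1)
  have "closedin mtopology cd_copulas"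
    unfolding closedin_metric
  proof (intro conjI allI impI)
    show "cd_copulas \<subseteq> copulas" by (auto simp: cd_copulas_def)
    fix C assume "C \<in> copulas - cd_copulas"
    then have C: "C \<in> copulas" and pos: "0 < spread C"
      using cd_copulas_iff_spread spread_nonneg by (auto simp: less_le)
    \<comment> \<open>by the Lipschitz property, no copula without spread is closer to \<open>C\<close> than \<open>spread C\<close>\<close>
    have "disjnt cd_copulas (mball C (spread C))"
      unfolding disjnt_iff
    proof (intro allI notI)
      fix C' assume "C' \<in> cd_copulas \<and> C' \<in> mball C (spread C)"
      then have C': "C' \<in> copulas" "D1 C C' < spread C" "spread C' = 0"
        using cd_copulas_iff_spread by auto
      with spread_Lipschitz[OF C C'(1)] show False by simp
    qed
    with pos show "\<exists>r>0. disjnt cd_copulas (mball C r)" by blast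
  qed
  moreover have "\<exists>f. continuous_map mtopology (subtopology mtopology (copulas - cd_copulas)) f \<and>
      (\<forall>C\<in>copulas. D1 C (f C) < \<epsilon> C)"
    if \<epsilon>: "continuous_map mtopology (top_of_set {0<..<1::real}) \<epsilon>" for \<epsilon>
  proof (intro exI conjI ballI)
    \<comment> \<open>half of \<open>\<epsilon> C\<close>, as the distance bound \<open>t\<close> for the blend is not strict\<close>
    define f where "f C = blend (\<epsilon> C / 2) C" for C
    have range: "0 < \<epsilon> C" "\<epsilon> C < 1" if "C \<in> copulas" for C
      using continuous_map_funspace[OF \<epsilon>] that by (auto simp: Pi_iff)
    have \<epsilon>': "continuous_map mtopology euclidean \<epsilon>"
      using \<epsilon> by (simp add: continuous_map_in_subtopology)
    have f: "f C \<in> copulas - cd_copulas" if "C \<in> copulas" for C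
      using range[OF that] that
      by (simp add: f_def blend_in_copulas blend_notin_cd_copulas)
    show "D1 C (f C) < \<epsilon> C" if C: "C \<in> copulas" for C
      using D1_blend_le[OF C, of "\<epsilon> C / 2"] range[OF C] by (simp add: f_def)
    have "continuous_map mtopology mtopology f"
      unfolding continuous_map_to_metric
    proof (intro ballI allI impI)
      fix C and e :: real assume "C \<in> topspace mtopology" and e: "0 < e"
      then have C: "C \<in> copulas" by simp
      define U where "U = mball C (e / 2) \<inter> {C' \<in> topspace mtopology. \<epsilon> C' \<in> ball (\<epsilon> C) e}"
      have "openin mtopology U"
        unfolding U_def using openin_continuous_map_preimage[OF \<epsilon>', of "ball (\<epsilon> C) e"]
        by (intro openin_Int openin_mball) simp
      moreover have "C \<in> U" using C e by (simp add: U_def)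
      moreover have "f C' \<in> mball (f C) e" if C': "C' \<in> U" for C'
      proof -
        have C'': "C' \<in> copulas" and d: "D1 C C' < e / 2" and \<epsilon>d: "\<bar>\<epsilon> C - \<epsilon> C'\<bar> < e"
          using C' by (auto simp: U_def dist_real_def)
        have "D1 (f C) (f C') \<le> D1 C C' + \<bar>\<epsilon> C / 2 - \<epsilon> C' / 2\<bar>"
          unfolding f_def using range[OF C] range[OF C''] by (intro D1_blend_blend_le C C'') auto
        also have "\<bar>\<epsilon> C / 2 - \<epsilon> C' / 2\<bar> = \<bar>\<epsilon> C - \<epsilon> C'\<bar> / 2"
          by (simp add: diff_divide_distrib[symmetric])
        also have "\<dots> < e / 2"
          using \<epsilon>d by simp
        finally have "D1 (f C) (f C') < e" using d by simp
        then show ?thesis using f[OF C] f[OF C''] by simp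
      qed
      ultimately show "\<exists>U. openin mtopology U \<and> C \<in> U \<and> (\<forall>C'\<in>U. f C' \<in> mball (f C) e)" by blast
    qed
    then show "continuous_map mtopology (subtopology mtopology (copulas - cd_copulas)) f"
      using f by (simp add: continuous_map_in_subtopology image_subset_iff_funcset[symmetric] image_subset_iff)
  qed
  ultimately show "Z_set cd_copulas"
    unfolding Z_set_def by blast
qed

end
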